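(* For every integer $n\ge 2$, the completely monotonic degree of the function $R_n(x)$ with respect to $x\in(0,+\infty)$ satisfies $$2(n-1)\le \deg^x_{cm}(R_n)<2n-1 .$$
   Context: A function $f$ is completely monotonic on an interval $I$ if it has derivatives of all orders on $I$ and $(-1)^k f^{(k)}(x)\ge 0$ for all $x\in I$ and all integers $k\ge 0$. Completely monotonic degree: let $f$ be completely monotonic on $(0,+\infty)$ and put $f(+\infty)=\lim_{x\to+\infty}f(x)\ge 0$. If the function $x^r[f(x)-f(+\infty)]$ is completely monotonic on $(0,+\infty)$ if and only if $0\le r\le\alpha$, then the number $\alpha$, denoted $\deg^x_{cm}[f]$, is called the completely monotonic degree of $f$ with respect to $x\in(0,+\infty)$. For integers $n\ge 0$ and $x>0$, $$R_n(x)=(-1)^n\left[\log\Gamma(x)-\left(x-\tfrac12\right)\log x+x-\tfrac12\log(2\pi)-\sum_{k=1}^n\frac{B_{2k}}{2k(2k-1)}\frac1{x^{2k-1}}\right],$$ where $\Gamma$ is the classical gamma function, an empty sum is $0$, and the Bernoulli numbers $B_{2k}$ are defined by $\frac{z}{e^z-1}=1-\frac z2+\sum_{k=1}^\infty\frac{B_{2k}}{(2k)!}z^{2k}$ for $|z|<2\pi$. It is known that each $R_n$ is completely monotonic on $(0,+\infty)$. *)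

theory Defs
  imports "HOL-Complex_Analysis.Complex_Analysis"
begin

text \<open>
  Here \<open>D k\<close> is the k-th derivative of \<open>f\<close> on the interval \<open>I\<close>. Derivatives are taken within
  \<open>I\<close>, so the definition also covers non-open (nondegenerate) intervals, depends only on the
  values of \<open>f\<close> on \<open>I\<close>, and uses the ordinary derivatives if \<open>I\<close> is open.
\<close>
definition completely_monotonic_on :: "real set \<Rightarrow> (real \<Rightarrow> real) \<Rightarrow> bool" where
  "completely_monotonic_on I f \<longleftrightarrow>
     (\<exists>D :: nat \<Rightarrow> real \<Rightarrow> real.
        (\<forall>x\<in>I. D 0 x = f x) \<and>
        (\<forall>k. \<forall>x\<in>I. (D k has_real_derivative D (Suc k) x) (at x within I)) \<and>
        (\<forall>k. \<forall>x\<in>I. (-1) ^ k * D k x \<ge> 0))"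

text \<open>
  The exponent \<open>r\<close> ranges over the nonnegative reals: for \<open>r < 0\<close> the function \<open>x powr r\<close> is
  itself completely monotonic, so the product always is, and an equivalence with
  \<open>0 \<le> r \<le> \<alpha>\<close> over all real \<open>r\<close> could never hold. For a completely monotonic \<open>f\<close> the limit
  at infinity exists and \<open>f\<close> minus that limit is completely monotonic; hence \<open>r = 0\<close> forces
  \<open>\<alpha> \<ge> 0\<close>, and \<open>\<alpha>\<close> is unique.
\<close>
definition has_cm_degree :: "(real \<Rightarrow> real) \<Rightarrow> real \<Rightarrow> bool" where
  "has_cm_degree f \<alpha> \<longleftrightarrow>
     completely_monotonic_on {0<..} f \<and>
     (\<forall>r\<ge>0. completely_monotonic_on {0<..} (\<lambda>x. x powr r * (f x - Lim at_top f)) \<longleftrightarrow> r \<le> \<alpha>)"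

definition cm_degree :: "(real \<Rightarrow> real) \<Rightarrow> real" where
  "cm_degree f = (THE \<alpha>. has_cm_degree f \<alpha>)"

text \<open>
  The generating function \<open>z / (exp z - 1)\<close> as a formal power series. Lemma
  \<open>bernoulli_even_sums\<close> is the corresponding analytic identity, with \<open>k\<close> shifted by one.
\<close>
definition bernoulli :: "nat \<Rightarrow> real" where
  "bernoulli n = fact n * fps_nth (fps_X / (fps_exp 1 - 1)) n"

lemma fps_nth_bernoulli_complex:
  "fps_nth (fps_X / (fps_exp 1 - 1) :: complex fps) n = of_real (bernoulli n / fact n)"
proof -
  define B :: "real fps" where "B = fps_X / (fps_exp 1 - 1)"
  define C :: "complex fps" where "C = Abs_fps (\<lambda>n. of_real (fps_nth B n))"
  have nz: "fps_exp 1 - 1 \<noteq> (0 :: 'a :: field_char_0 fps)"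
    by (auto simp: fps_eq_iff intro!: exI[of _ 1])
  have sd: "subdegree (fps_exp 1 - 1 :: 'a :: field_char_0 fps) = 1"
    by (rule subdegreeI) auto
  have "B * (fps_exp 1 - 1) = fps_X"
    unfolding B_def by (intro dvd_div_mult_self, subst fps_dvd_iff) (simp_all only: nz sd, auto)
  hence *: "fps_nth (B * (fps_exp 1 - 1)) m = fps_nth fps_X m" for m
    by simp
  have "C * (fps_exp 1 - 1) = fps_X"
  proof (rule fps_ext)
    fix m
    have "fps_nth (C * (fps_exp 1 - 1)) m = of_real (fps_nth (B * (fps_exp 1 - 1)) m)"
      unfolding fps_mult_nth C_def of_real_sum by (intro sum.cong) auto
    thus "fps_nth (C * (fps_exp 1 - 1)) m = fps_nth fps_X m"
      by (simp add: * fps_X_def)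
  qed
  hence "fps_X / (fps_exp 1 - 1) = C"
    using nz by (metis nonzero_mult_div_cancel_right)
  thus ?thesis
    by (simp add: C_def B_def bernoulli_def)
qed

lemma bernoulli_even_sums:
  fixes z :: complex
  assumes "z \<noteq> 0" "norm z < 2 * pi"
  shows   "(\<lambda>k. of_real (bernoulli (2 * (k + 1)) / fact (2 * (k + 1))) * z ^ (2 * (k + 1)))
             sums (z / (exp z - 1) - (1 - z / 2))"
proof -
  define h where "h = (\<lambda>z::complex. if z = 0 then 1 else z / (exp z - 1))"
  define F :: "complex fps" where "F = fps_X / (fps_exp 1 - 1)"
  define a where "a = fps_nth F"
  have sd: "subdegree (fps_exp 1 - 1 :: complex fps) = 1"
    by (rule subdegreeI) auto
  have nz: "fps_exp 1 - 1 \<noteq> (0 :: complex fps)"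
    by (auto simp: fps_eq_iff intro!: exI[of _ 1])
  have exp: "h has_fps_expansion F"
    unfolding h_def F_def
    by (intro has_fps_expansion_divide has_fps_expansion_fps_X has_fps_expansion_diff
          has_fps_expansion_exp1 has_fps_expansion_1) (simp_all only: sd nz, auto)
  have exp_ne: "exp w \<noteq> 1" if "w \<noteq> 0" "norm w < 2 * pi" for w :: complex
  proof
    assume "exp w = 1"
    then obtain n :: int where n: "Re w = 0" "Im w = of_int (2 * n) * pi"
      by (auto simp: exp_eq_1)
    with that have "n \<noteq> 0"
      by (auto simp: complex_eq_iff)
    hence "1 \<le> \<bar>real_of_int n\<bar>"
      by linarith
    hence "2 * pi * 1 \<le> 2 * pi * \<bar>real_of_int n\<bar>"
      by (intro mult_left_mono) auto
    also have "\<dots> = \<bar>Im w\<bar>"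
      by (simp add: n abs_mult)
    finally show False
      using abs_Im_le_cmod[of w] that by linarith
  qed
  have "(\<lambda>z. z / (exp z - 1)) holomorphic_on (ball 0 (2 * pi) - {0})"
    using exp_ne by (intro holomorphic_intros) auto
  hence "h holomorphic_on (ball 0 (2 * pi) - {0})"
    by (rule holomorphic_transform) (auto simp: h_def)
  hence "h analytic_on (ball 0 (2 * pi) - {0})"
    by (subst analytic_on_open) auto
  moreover have "h analytic_on {0}"
    using exp by (rule has_fps_expansion_imp_analytic_0)
  ultimately have "h analytic_on (ball 0 (2 * pi) - {0}) \<union> {0}"
    by (simp only: analytic_on_Un)
  hence "h holomorphic_on ball 0 (2 * pi)"
    by (intro analytic_imp_holomorphic) (auto elim!: analytic_on_subset)
  hence sums: "(\<lambda>n. a n * w ^ n) sums h w" if "norm w < 2 * pi" for w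
    unfolding a_def using that
    by (intro has_fps_expansion_imp_sums_complex[OF exp, where r = "2 * pi"]) auto
  have "(\<lambda>n. (a n * z ^ n + a n * (-z) ^ n) / 2) sums ((h z + h (-z)) / 2)"
    using assms by (intro sums_divide sums_add sums) auto
  also have "(h z + h (-z)) / 2 = z / (exp z - 1) + z / 2"
    using assms exp_ne[of z] exp_ne[of "-z"]
    by (simp add: h_def exp_minus divide_simps) (auto simp: algebra_simps)
  finally have *: "(\<lambda>n. (a n * z ^ n + a n * (-z) ^ n) / 2) sums (z / (exp z - 1) + z / 2)" .
  have odd: "odd n" if "n \<notin> range ((*) 2)" for n :: nat
    using that by (auto elim!: evenE)
  have "(\<lambda>n. (a (2 * n) * z ^ (2 * n) + a (2 * n) * (-z) ^ (2 * n)) / 2)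
                   sums (z / (exp z - 1) + z / 2)"
    using * by (subst sums_mono_reindex) (auto simp: strict_mono_def dest!: odd)
  hence "(\<lambda>n. a (2 * n) * z ^ (2 * n)) sums (z / (exp z - 1) + z / 2)"
    by simp
  moreover have "a 0 = 1"
    using has_fps_expansion_imp_0_eq_fps_nth_0[OF exp] by (simp add: h_def a_def)
  ultimately have "(\<lambda>n. a (2 * Suc n) * z ^ (2 * Suc n)) sums (z / (exp z - 1) + z / 2 - 1)"
    by (subst sums_Suc_iff) auto
  thus ?thesis
    by (simp add: a_def F_def fps_nth_bernoulli_complex algebra_simps)
qed

definition gamma_remainder :: "nat \<Rightarrow> real \<Rightarrow> real" where
  "gamma_remainder n x = (-1) ^ n *
     (ln (Gamma x) - (x - 1 / 2) * ln x + x - 1 / 2 * ln (2 * pi) -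
      (\<Sum>k=1..n. bernoulli (2 * k) / (2 * real k * (2 * real k - 1)) * (1 / x ^ (2 * k - 1))))"

end

theory Submission
  imports Defs "HOL-Probability.Distributions" "HOL-Real_Asymp.Real_Asymp"
begin

text \<open>
  Put \<open>p = n - 1\<close> and \<open>a\<^sub>m = 2\<pi>m\<close>. Binet's formula and the partial fractions of \<open>coth\<close> write
  \<open>ln \<Gamma>\<close> minus its Stirling main term as the Laplace transform of \<open>\<Sum>m. 2 / (t\<^sup>2 + a\<^sub>m\<^sup>2)\<close>. The functions
  \<open>E\<^sub>N(x) = \<integral> (1 + \<i>t/a)\<^sup>-\<^sup>N exp (-x t) dt\<close> satisfy \<open>x E\<^sub>N = 1 - (\<i>N/a) E\<^bsub>N+1\<^esub>\<close>, and \<open>2p\<close> steps of this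
  recursion, starting from \<open>Re E\<^sub>1\<close>, give
  \<open>x\<^bsup>2p\<^esup> R\<^sub>n(x) = (2p)! (C / x - L[P](x))\<close> with \<open>P(t) = \<Sum>m. 2 a\<^sub>m\<^bsup>-2n\<^esup> Re (1 + \<i>t/a\<^sub>m)\<^bsup>-(2n-1)\<^esup>\<close> and \<open>C = P(0)\<close>.
  Since \<open>\<bar>P\<bar> \<le> C\<close>, this is the Laplace transform of the nonnegative function \<open>C - P\<close>, hence completely
  monotonic. If \<open>x\<^bsup>2p+1\<^esup> R\<^sub>n\<close>, a multiple of \<open>C - x L[P](x)\<close>, were completely monotonic too, then \<open>P\<close> would
  be nonnegative, but \<open>P\<close> is negative at \<open>2\<pi> tan (\<pi> / (2n-1))\<close>. Finally, the exponents \<open>r \<ge> 0\<close> with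
  \<open>x\<^sup>r R\<^sub>n\<close> completely monotonic form a closed interval starting at \<open>0\<close>, so the degree exists and
  the upper bound is strict.
\<close>

section \<open>Laplace transforms\<close>

text \<open>Up to the sign \<open>(-1) ^ k\<close>, this is the k-th derivative of the Laplace
  transform for the bounded measurable functions considered here. Banach space values cover the real
  densities and the complex pole kernels at once, and the indicator makes the values at negative
  \<open>t\<close> irrelevant.\<close>

definition laplace_moment :: "(real \<Rightarrow> 'a :: {banach, second_countable_topology}) \<Rightarrow> nat \<Rightarrow> real \<Rightarrow> 'a" where
  "laplace_moment f k x = (\<integral>t. (indicator {0..} t * (t ^ k * exp (- x * t))) *\<^sub>R f t \<partial>lborel)"

text \<open>The weight is \<open>1 / x\<close> times the exponential density of rate
  \<open>x\<close>, which is the Erlang density of index 0, so the integral is one of its known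
  moments.\<close>

lemma has_bochner_integral_power_exp:
  fixes x :: real
  assumes "x > 0"
  shows "has_bochner_integral lborel (\<lambda>t. indicator {0..} t * (t ^ k * exp (- x * t))) (fact k / x ^ Suc k)"
proof (rule has_bochner_integral_nn_integral)
  have "(\<integral>\<^sup>+ t. ennreal (indicator {0..} t * (t ^ k * exp (- x * t))) \<partial>lborel)
      = (\<integral>\<^sup>+ t. ennreal (1 / x) * ennreal (erlang_density 0 x t * t ^ k) \<partial>lborel)"
    using assms
    by (intro nn_integral_cong) (auto simp: erlang_density_def indicator_def simp flip: ennreal_mult')
  also have "\<dots> = ennreal (1 / x) * ennreal (fact k / x ^ k)"
    by (subst nn_integral_cmult) (use assms in \<open>auto simp: nn_integral_erlang_ith_moment\<close>)
  also have "\<dots> = ennreal (fact k / x ^ Suc k)"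
    using assms by (simp flip: ennreal_mult')
  finally show "(\<integral>\<^sup>+ t. ennreal (indicator {0..} t * (t ^ k * exp (- x * t))) \<partial>lborel)
      = ennreal (fact k / x ^ Suc k)" .
qed (use assms in \<open>auto simp: indicator_def\<close>)

lemmas integrable_power_exp = has_bochner_integral_power_exp[THEN integrable.intros]
lemmas integral_power_exp = has_bochner_integral_power_exp[THEN has_bochner_integral_integral_eq]

lemma integrable_laplace_moment:
  fixes f :: "real \<Rightarrow> 'a :: {banach, second_countable_topology}"
  assumes [measurable]: "f \<in> borel_measurable borel" and "\<And>t. t \<ge> 0 \<Longrightarrow> norm (f t) \<le> M" and "x > 0"
  shows "integrable lborel (\<lambda>t. (indicator {0..} t * (t ^ k * exp (- x * t))) *\<^sub>R f t)"
proof (rule Bochner_Integration.integrable_bound)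
  show "integrable lborel (\<lambda>t. M * (indicator {0..} t * (t ^ k * exp (- x * t))))"
    by (intro integrable_mult_right integrable_power_exp assms)
  have "M \<ge> 0"
    using assms(2)[of 0] norm_ge_zero[of "f 0"] by linarith
  thus "AE t in lborel. norm ((indicator {0..} t * (t ^ k * exp (- x * t))) *\<^sub>R f t)
             \<le> norm (M * (indicator {0..} t * (t ^ k * exp (- x * t))))"
    using assms(2) by (auto simp: indicator_def abs_mult mult.commute intro!: mult_right_mono)
qed simp

lemma norm_laplace_moment_le:
  fixes f :: "real \<Rightarrow> 'a :: {banach, second_countable_topology}"
  assumes [measurable]: "f \<in> borel_measurable borel" and "\<And>t. t \<ge> 0 \<Longrightarrow> norm (f t) \<le> M" and "x > 0"
  shows "norm (laplace_moment f k x) \<le> M * fact k / x ^ Suc k"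
proof -
  have "norm (laplace_moment f k x) \<le> (\<integral>t. M * (indicator {0..} t * (t ^ k * exp (- x * t))) \<partial>lborel)"
    unfolding laplace_moment_def
  proof (rule Bochner_Integration.integral_norm_bound_integral)
    show "integrable lborel (\<lambda>t. M * (indicator {0..} t * (t ^ k * exp (- x * t))))"
      by (intro integrable_mult_right integrable_power_exp assms)
    show "integrable lborel (\<lambda>t. (indicator {0..} t * (t ^ k * exp (- x * t))) *\<^sub>R f t)"
      by (rule integrable_laplace_moment) (use assms in auto)
  qed (use assms in \<open>auto intro!: mult_right_mono simp: indicator_def mult.commute\<close>)
  also have "\<dots> = M * fact k / x ^ Suc k"
    using integral_power_exp[OF assms(3), of k] by simp
  finally show ?thesis .
qed

lemma laplace_moment_mono:
  fixes f g :: "real \<Rightarrow> real"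
  assumes [measurable]: "f \<in> borel_measurable borel" "g \<in> borel_measurable borel"
    and "\<And>t. t \<ge> 0 \<Longrightarrow> \<bar>f t\<bar> \<le> M" "\<And>t. t \<ge> 0 \<Longrightarrow> f t \<le> g t" "x > 0"
    and "integrable lborel (\<lambda>t. (indicator {0..} t * (t ^ k * exp (- x * t))) *\<^sub>R g t)"
  shows "laplace_moment f k x \<le> laplace_moment g k x"
  unfolding laplace_moment_def
proof (rule integral_mono)
  show "integrable lborel (\<lambda>t. (indicator {0..} t * (t ^ k * exp (- x * t))) *\<^sub>R f t)"
    by (rule integrable_laplace_moment) (use assms in auto)
qed (use assms in \<open>auto simp: indicator_def intro!: mult_left_mono\<close>)

text \<open>The integrals of the norms are dominated by \<open>M m * (fact k / x ^ Suc k)\<close>, a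
  summable sequence, so sum and integral may be exchanged.\<close>

lemma laplace_moment_sums:
  fixes f :: "nat \<Rightarrow> real \<Rightarrow> 'a :: {banach, second_countable_topology}"
  assumes [measurable]: "\<And>m. f m \<in> borel_measurable borel"
    and f: "\<And>m t. t \<ge> 0 \<Longrightarrow> norm (f m t) \<le> M m" and M: "summable M" and x: "x > 0"
  shows "(\<lambda>m. laplace_moment (f m) k x) sums laplace_moment (\<lambda>t. \<Sum>m. f m t) k x"
proof -
  define w :: "real \<Rightarrow> real" where "w = (\<lambda>t. indicator {0..} t * (t ^ k * exp (- x * t)))"
  have w: "w t \<ge> 0" "t < 0 \<Longrightarrow> w t = 0" for t
    by (auto simp: w_def indicator_def)
  have summ: "summable (\<lambda>m. norm (f m t))" if "t \<ge> 0" for t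
    using f that by (intro summable_comparison_test'[OF M, of 0]) auto
  have int: "integrable lborel (\<lambda>t. w t *\<^sub>R f m t)" for m
    unfolding w_def using f x by (intro integrable_laplace_moment) auto
  have "(\<lambda>m. \<integral>t. w t *\<^sub>R f m t \<partial>lborel) sums (\<integral>t. (\<Sum>m. w t *\<^sub>R f m t) \<partial>lborel)"
  proof (rule sums_integral[OF int])
    show "AE t in lborel. summable (\<lambda>m. norm (w t *\<^sub>R f m t))"
    proof (intro AE_I2)
      fix t
      show "summable (\<lambda>m. norm (w t *\<^sub>R f m t))"
        using summ[of t] w(2)[of t] by (cases "t \<ge> 0") (simp_all add: summable_mult)
    qed
    show "summable (\<lambda>m. \<integral>t. norm (w t *\<^sub>R f m t) \<partial>lborel)"
    proof (rule summable_comparison_test'[of "\<lambda>m. M m * (fact k / x ^ Suc k)" 0])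
      fix m
      have "(\<integral>t. norm (w t *\<^sub>R f m t) \<partial>lborel) \<le> (\<integral>t. M m * w t \<partial>lborel)"
      proof (rule integral_mono)
        show "integrable lborel (\<lambda>t. M m * w t)"
          unfolding w_def by (intro integrable_mult_right integrable_power_exp x)
        show "integrable lborel (\<lambda>t. norm (w t *\<^sub>R f m t))"
          by (intro integrable_norm int)
      qed (use f w in \<open>auto simp: w_def indicator_def mult.commute intro!: mult_right_mono\<close>)
      also have "\<dots> = M m * (fact k / x ^ Suc k)"
        unfolding w_def using integral_power_exp[OF x, of k] by simp
      finally show "norm (\<integral>t. norm (w t *\<^sub>R f m t) \<partial>lborel) \<le> M m * (fact k / x ^ Suc k)"
        by simp
    qed (intro summable_mult2 M)
  qed
  also have "(\<lambda>t. \<Sum>m. w t *\<^sub>R f m t) = (\<lambda>t. w t *\<^sub>R (\<Sum>m. f m t))"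
  proof
    fix t
    show "(\<Sum>m. w t *\<^sub>R f m t) = w t *\<^sub>R (\<Sum>m. f m t)"
    proof (cases "t \<ge> 0")
      case True
      thus ?thesis
        using suminf_scaleR_right[OF summable_norm_cancel[OF summ[of t]], of "w t"] by simp
    next
      \<comment> \<open>The series need not converge at a negative \<open>t\<close>, but there the
        weight vanishes and both sides are 0.\<close>
      case False
      thus ?thesis
        using w(2)[of t] by simp
    qed
  qed
  finally show ?thesis
    by (simp add: laplace_moment_def w_def)
qed

section \<open>Differentiation under the integral sign\<close>

lemma exp_diff_linear_bound:
  fixes u v :: real
  shows "\<bar>exp u - exp v - (u - v) * exp v\<bar> \<le> (u - v)\<^sup>2 / 2 * exp (max u v)"
proof (cases "u = v")
  case False
  have "\<exists>t. (if u < v then u < t \<and> t < v else v < t \<and> t < u) \<and>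
          exp u = (\<Sum>m<2. exp v / fact m * (u - v) ^ m) + exp t / fact 2 * (u - v) ^ 2"
    using False
    by (intro Taylor[of 2 "\<lambda>_. exp" _ "min u v" "max u v"]) (auto intro!: derivative_eq_intros)
  then obtain t where t: "t \<le> max u v"
      "exp u = (\<Sum>m<2. exp v / fact m * (u - v) ^ m) + exp t / fact 2 * (u - v) ^ 2"
    by (auto split: if_splits)
  have "\<bar>exp u - exp v - (u - v) * exp v\<bar> = (u - v)\<^sup>2 / 2 * exp t"
  proof -
    have "exp u - exp v - (u - v) * exp v = (u - v)\<^sup>2 / 2 * exp t"
      by (subst t(2)) (simp add: numeral_2_eq_2 algebra_simps)
    thus ?thesis
      by (simp only: abs_mult) simp
  qed
  also have "\<dots> \<le> (u - v)\<^sup>2 / 2 * exp (max u v)"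
    using t(1) by (intro mult_left_mono) auto
  finally show ?thesis .
qed auto

lemma has_real_derivative_quadratic_error:
  fixes f :: "real \<Rightarrow> real"
  assumes "d > 0" and "\<And>y. \<bar>y - x\<bar> < d \<Longrightarrow> \<bar>f y - f x - (y - x) * D\<bar> \<le> K * (y - x)\<^sup>2"
  shows "(f has_real_derivative D) (at x)"
proof -
  have "((\<lambda>y. (f y - f x) / (y - x) - D) \<longlongrightarrow> 0) (at x)"
  proof (rule Lim_null_comparison)
    show "\<forall>\<^sub>F y in at x. norm ((f y - f x) / (y - x) - D) \<le> K * \<bar>y - x\<bar>"
      unfolding eventually_at
    proof (intro exI[of _ d] conjI ballI impI assms)
      fix y assume y: "y \<noteq> x \<and> dist y x < d"
      hence "\<bar>(f y - f x) / (y - x) - D\<bar> = \<bar>f y - f x - (y - x) * D\<bar> / \<bar>y - x\<bar>"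
        by (simp add: field_simps flip: abs_divide)
      also have "\<dots> \<le> K * (y - x)\<^sup>2 / \<bar>y - x\<bar>"
        using y by (intro divide_right_mono assms) (auto simp: dist_real_def)
      also have "\<dots> = K * \<bar>y - x\<bar>"
        using y by (simp add: power2_eq_square field_simps abs_if)
      finally show "norm ((f y - f x) / (y - x) - D) \<le> K * \<bar>y - x\<bar>"
        by simp
    qed
    have "((\<lambda>y. K * \<bar>y - x\<bar>) \<longlongrightarrow> K * \<bar>x - x\<bar>) (at x)"
      by (intro tendsto_intros)
    thus "((\<lambda>y. K * \<bar>y - x\<bar>) \<longlongrightarrow> 0) (at x)"
      by simp
  qed
  thus ?thesis
    using Lim_null has_field_derivative_iff by blast
qed

text \<open>For \<open>y\<close> within \<open>x / 2\<close> of \<open>x\<close>, the linearisation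
  error of \<open>exp (- y * t)\<close> is at most
  \<open>(y - x)\<^sup>2 * t\<^sup>2 / 2 * exp (- (x / 2) * t)\<close>. Integrating this against
  \<open>f\<close> leaves an error quadratic in \<open>y - x\<close>, which is enough for
  differentiability.\<close>

lemma has_real_derivative_laplace_moment:
  fixes f :: "real \<Rightarrow> real"
  assumes [measurable]: "f \<in> borel_measurable borel" and f: "\<And>t. t \<ge> 0 \<Longrightarrow> \<bar>f t\<bar> \<le> M" and x: "x > 0"
  shows "(laplace_moment f k has_real_derivative - laplace_moment f (Suc k) x) (at x)"
proof (rule has_real_derivative_quadratic_error[of "x / 2"])
  fix y assume y: "\<bar>y - x\<bar> < x / 2"
  hence y': "y > x / 2"
    by linarith
  let ?w = "\<lambda>k x t :: real. indicator {0..} t * (t ^ k * exp (- x * t)) :: real"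
  have M: "M \<ge> 0"
    using f[of 0] abs_ge_zero[of "f 0"] by linarith
  have eq: "laplace_moment f k y - laplace_moment f k x - (y - x) * - laplace_moment f (Suc k) x
      = (\<integral>t. ?w k y t *\<^sub>R f t - ?w k x t *\<^sub>R f t - (y - x) *\<^sub>R (- (?w (Suc k) x t *\<^sub>R f t)) \<partial>lborel)"
  proof -
    have "integrable lborel (\<lambda>t. ?w k y t *\<^sub>R f t)" "integrable lborel (\<lambda>t. ?w k x t *\<^sub>R f t)"
         "integrable lborel (\<lambda>t. ?w (Suc k) x t *\<^sub>R f t)"
      using x y' f by (intro integrable_laplace_moment[where M = M] assms(1); simp)+
    thus ?thesis
      unfolding laplace_moment_def by (simp add: ring_distribs)
  qed
  have "\<bar>laplace_moment f k y - laplace_moment f k x - (y - x) * - laplace_moment f (Suc k) x\<bar>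
      \<le> (\<integral>t. (M * (y - x)\<^sup>2 / 2) * ?w (k + 2) (x / 2) t \<partial>lborel)"
    unfolding eq real_norm_def[symmetric]
  proof (rule Bochner_Integration.integral_norm_bound_integral)
    show "integrable lborel (\<lambda>t. (M * (y - x)\<^sup>2 / 2) * ?w (k + 2) (x / 2) t)"
      using x by (intro integrable_mult_right integrable_power_exp) auto
    show "integrable lborel (\<lambda>t. ?w k y t *\<^sub>R f t - ?w k x t *\<^sub>R f t - (y - x) *\<^sub>R (- (?w (Suc k) x t *\<^sub>R f t)))"
      using x y' f by (intro Bochner_Integration.integrable_diff integrable_scaleR_right
          integrable_minus integrable_laplace_moment) auto
    fix t :: real
    show "norm (?w k y t *\<^sub>R f t - ?w k x t *\<^sub>R f t - (y - x) *\<^sub>R (- (?w (Suc k) x t *\<^sub>R f t)))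
        \<le> (M * (y - x)\<^sup>2 / 2) * ?w (k + 2) (x / 2) t"
    proof (cases "t \<ge> 0")
      case t: True
      have "norm (?w k y t *\<^sub>R f t - ?w k x t *\<^sub>R f t - (y - x) *\<^sub>R (- (?w (Suc k) x t *\<^sub>R f t)))
          = \<bar>f t * t ^ k * (exp (- y * t) - exp (- x * t) - (- y * t - - x * t) * exp (- x * t))\<bar>"
        using t unfolding real_norm_def by (intro arg_cong[where f = abs]) (simp add: algebra_simps)
      also have "\<dots> = \<bar>f t\<bar> * t ^ k * \<bar>exp (- y * t) - exp (- x * t) - (- y * t - - x * t) * exp (- x * t)\<bar>"
        using t by (simp add: abs_mult)
      also have "\<dots> \<le> M * t ^ k * ((- y * t - - x * t)\<^sup>2 / 2 * exp (max (- y * t) (- x * t)))"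
        using t M by (intro mult_mono exp_diff_linear_bound f) auto
      also have "\<dots> \<le> M * t ^ k * ((- y * t - - x * t)\<^sup>2 / 2 * exp (- (x / 2) * t))"
      proof -
        have "x / 2 * t \<le> y * t" "x / 2 * t \<le> x * t"
          using t y' x mult_right_mono[of "x / 2" y t] mult_right_mono[of "x / 2" x t] by auto
        thus ?thesis
          using t M by (intro mult_left_mono) auto
      qed
      also have "\<dots> = (M * (y - x)\<^sup>2 / 2) * ?w (k + 2) (x / 2) t"
        using t by (simp add: power2_eq_square algebra_simps)
      finally show ?thesis .
    qed auto
  qed
  also have "\<dots> = (M / 2 * (fact (k + 2) / (x / 2) ^ Suc (k + 2))) * (y - x)\<^sup>2"
  proof -
    have "x / 2 > 0"
      using x by simp
    from integral_power_exp[OF this, of "k + 2"] show ?thesis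
      by (simp only: integral_mult_right_zero) (simp only: times_divide_eq_left times_divide_eq_right ac_simps)
  qed
  finally show "\<bar>laplace_moment f k y - laplace_moment f k x - (y - x) * - laplace_moment f (Suc k) x\<bar>
     \<le> (M / 2 * (fact (k + 2) / (x / 2) ^ Suc (k + 2))) * (y - x)\<^sup>2" .
qed (use x in auto)

text \<open>
  If \<open>f s < 0\<close>, then \<open>f\<close> lies below a parabola \<open>f s / 2 + C (t - s)\<^sup>2\<close>. The weight \<open>t\<^sup>k exp (-x t)\<close> with
  \<open>x = (k + 1) / s\<close> has mean \<open>s\<close> and variance \<open>s\<^sup>2 / (k + 1)\<close>, so it gives the parabola a negative
  integral for large \<open>k\<close>.
\<close>
lemma laplace_moment_nonneg_imp_nonneg:
  fixes f :: "real \<Rightarrow> real"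
  assumes [measurable]: "f \<in> borel_measurable borel" and f: "\<And>t. t \<ge> 0 \<Longrightarrow> \<bar>f t\<bar> \<le> M"
    and cont: "isCont f s" and s: "s > 0"
    and nonneg: "\<And>k x. x > 0 \<Longrightarrow> laplace_moment f k x \<ge> 0"
  shows "f s \<ge> 0"
proof (rule ccontr)
  assume "\<not> f s \<ge> 0"
  hence neg: "f s < 0"
    by simp
  have M: "M \<ge> 0"
    using f[of 0] abs_ge_zero[of "f 0"] by linarith
  have "\<forall>\<^sub>F t in nhds s. f t < f s / 2"
    using cont neg by (intro order_tendstoD(2)[of f "f s"]) (auto simp: isCont_def tendsto_nhds_iff)
  then obtain d where d: "d > 0" "\<And>t. \<bar>t - s\<bar> < d \<Longrightarrow> f t < f s / 2"
    by (auto simp: eventually_nhds_metric dist_real_def)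
  \<comment> \<open>With this choice \<open>C * d\<^sup>2 = 2 * M\<close>, so at distance at least
    \<open>d\<close> from \<open>s\<close> the parabola already exceeds every possible value of
    \<open>f\<close>.\<close>
  define C where "C = 2 * M / d\<^sup>2"
  have C: "C \<ge> 0"
    using M by (simp add: C_def)
  have majorant: "f t \<le> f s / 2 + C * (t - s)\<^sup>2" if "t \<ge> 0" for t
  proof (cases "\<bar>t - s\<bar> < d")
    case True
    have "C * (t - s)\<^sup>2 \<ge> 0"
      using C by simp
    thus ?thesis
      using d(2)[OF True] by linarith
  next
    case False
    have "f t - f s / 2 \<le> 2 * M"
      using f[OF that] f[of s] s M by (simp add: abs_le_iff)
    also have "2 * M = C * d\<^sup>2"
      using d(1) by (simp add: C_def)
    also have "\<dots> \<le> C * (t - s)\<^sup>2"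
      using False C d(1) by (intro mult_left_mono) (auto simp: abs_le_square_iff[symmetric])
    finally show ?thesis
      by simp
  qed
  \<comment> \<open>The variance term \<open>C * s\<^sup>2 / (k + 1)\<close> has to be smaller than
    \<open>- f s / 2\<close>.\<close>
  obtain k :: nat where k: "C * s\<^sup>2 / (- f s / 2) < real k"
    using reals_Archimedean2 by blast
  define x where "x = (real k + 1) / s"
  have x: "x > 0"
    using s by (simp add: x_def)
  let ?w = "\<lambda>k t. indicator {0..} t * (t ^ k * exp (- x * t)) :: real"
  have expand: "?w k t *\<^sub>R (f s / 2 + C * (t - s)\<^sup>2)
      = C * ?w (k + 2) t - 2 * C * s * ?w (Suc k) t + (f s / 2 + C * s\<^sup>2) * ?w k t" for t
    by (simp add: power2_eq_square algebra_simps)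
  have bi: "has_bochner_integral lborel (\<lambda>t. ?w k t *\<^sub>R (f s / 2 + C * (t - s)\<^sup>2))
      (C * (fact (k + 2) / x ^ Suc (k + 2)) - 2 * C * s * (fact (Suc k) / x ^ Suc (Suc k))
        + (f s / 2 + C * s\<^sup>2) * (fact k / x ^ Suc k))"
    unfolding expand
    by (intro has_bochner_integral_add has_bochner_integral_diff has_bochner_integral_mult_right has_bochner_integral_power_exp x)
  have "0 \<le> laplace_moment f k x"
    by (rule nonneg) (fact x)
  also have "\<dots> \<le> laplace_moment (\<lambda>t. f s / 2 + C * (t - s)\<^sup>2) k x"
    using f majorant x bi by (intro laplace_moment_mono[where M = M]) (auto simp: has_bochner_integral_iff)
  also have "\<dots> = fact k / x ^ Suc k * (f s / 2 + C * ((real k + 2) * (real k + 1) / x\<^sup>2 - 2 * s * (real k + 1) / x + s\<^sup>2))"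
    using x unfolding laplace_moment_def has_bochner_integral_integral_eq[OF bi]
    by (simp add: field_simps power2_eq_square)
  also have "(real k + 2) * (real k + 1) / x\<^sup>2 - 2 * s * (real k + 1) / x + s\<^sup>2 = s\<^sup>2 / (real k + 1)"
  proof -
    have "(real k + 2) * (real k + 1) / x\<^sup>2 = (real k + 2) / (real k + 1) * s\<^sup>2"
      by (simp add: x_def power_divide) (simp add: power2_eq_square)
    moreover have "2 * s * (real k + 1) / x = 2 * s\<^sup>2"
      using s by (simp add: x_def power2_eq_square)
    moreover have "(real k + 2) / (real k + 1) = 1 + 1 / (real k + 1)"
      by (simp add: field_simps)
    ultimately show ?thesis
      by (simp add: ring_distribs)
  qed
  finally have "fact k / x ^ Suc k * 0 \<le> fact k / x ^ Suc k * (f s / 2 + C * (s\<^sup>2 / (real k + 1)))"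
    by simp
  hence "0 \<le> f s / 2 + C * (s\<^sup>2 / (real k + 1))"
    using x by (subst (asm) mult_le_cancel_left_pos) (simp_all del: power_Suc)
  moreover have "C * (s\<^sup>2 / (real k + 1)) < - f s / 2"
  proof -
    have "C * s\<^sup>2 < real k * (- f s / 2)"
      using k neg by (subst (asm) pos_divide_less_eq) auto
    also have "\<dots> \<le> (real k + 1) * (- f s / 2)"
      using neg by (intro mult_right_mono) auto
    finally show ?thesis
      by (simp add: field_simps)
  qed
  ultimately show False
    by linarith
qed

section \<open>Powers of a simple pole\<close>

lemma integral_FTC_at_top:
  fixes F :: "real \<Rightarrow> 'a :: euclidean_space"
  assumes deriv: "\<And>t. (F has_vector_derivative f t) (at t)" and cont: "continuous_on UNIV f"
    and int: "integrable lborel (\<lambda>t. indicator {0..} t *\<^sub>R f t)" and lim: "(F \<longlongrightarrow> 0) at_top"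
  shows "(\<integral>t. indicator {0..} t *\<^sub>R f t \<partial>lborel) = - F 0"
proof -
  have "((\<lambda>b. \<integral>t. indicator {..b} t *\<^sub>R (indicator {0..} t *\<^sub>R f t) \<partial>lborel) \<longlongrightarrow>
          (\<integral>t. indicator {0..} t *\<^sub>R f t \<partial>lborel)) at_top"
    by (intro tendsto_integral_at_top int) auto
  moreover have "((\<lambda>b. \<integral>t. indicator {..b} t *\<^sub>R (indicator {0..} t *\<^sub>R f t) \<partial>lborel) \<longlongrightarrow> 0 - F 0) at_top"
  proof (rule Lim_transform_eventually)
    show "((\<lambda>b. F b - F 0) \<longlongrightarrow> 0 - F 0) at_top"
      by (intro tendsto_intros lim)
    show "\<forall>\<^sub>F b in at_top. F b - F 0 = (\<integral>t. indicator {..b} t *\<^sub>R (indicator {0..} t *\<^sub>R f t) \<partial>lborel)"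
      using eventually_ge_at_top[of 0]
    proof eventually_elim
      case (elim b)
      have "has_bochner_integral lborel (\<lambda>t. indicator {0..b} t *\<^sub>R f t) (F b - F 0)"
        using elim deriv cont
        by (intro has_bochner_integral_FTC_Icc) (auto intro: has_vector_derivative_at_within continuous_on_subset)
      hence "(\<integral>t. indicator {0..b} t *\<^sub>R f t \<partial>lborel) = F b - F 0"
        by (rule has_bochner_integral_integral_eq)
      moreover have "(\<lambda>t. indicator {..b} t *\<^sub>R (indicator {0..} t *\<^sub>R f t)) = (\<lambda>t. indicator {0..b} t *\<^sub>R f t)"
        by (auto simp: indicator_def)
      ultimately show ?case
        by simp
    qed
  qed
  ultimately have "(\<integral>t. indicator {0..} t *\<^sub>R f t \<partial>lborel) = 0 - F 0"
    by (intro tendsto_unique[of at_top]) auto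
  thus ?thesis
    by simp
qed

text \<open>Up to a constant factor this is a power of \<open>1 / (t - \<i> * a)\<close>. The
  normalisation gives value 1 at \<open>t = 0\<close> and modulus at most 1 on the real
  line.\<close>

definition pole_kernel :: "real \<Rightarrow> nat \<Rightarrow> real \<Rightarrow> complex" where
  "pole_kernel a N t = 1 / (1 + \<i> * of_real t / of_real a) ^ N"

definition pole_laplace :: "real \<Rightarrow> nat \<Rightarrow> real \<Rightarrow> complex" where
  "pole_laplace a N = laplace_moment (pole_kernel a N) 0"

lemma pole_nonzero: "1 + \<i> * of_real t / of_real a \<noteq> (0 :: complex)"
  by (simp add: complex_eq_iff)

lemma norm_pole_ge_1: "norm (1 + \<i> * of_real t / of_real a :: complex) \<ge> 1"
  using abs_Re_le_cmod[of "1 + \<i> * of_real t / of_real a"] by simp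

lemma norm_pole_kernel_le_1: "norm (pole_kernel a N t) \<le> 1"
proof -
  have "1 \<le> norm (1 + \<i> * of_real t / of_real a :: complex) ^ N"
    using norm_pole_ge_1 by (intro one_le_power)
  thus ?thesis
    by (simp add: pole_kernel_def norm_divide norm_power field_simps)
qed

lemma continuous_on_pole_kernel: "continuous_on A (pole_kernel a N)"
proof -
  have "continuous_on A (\<lambda>t. 1 / (1 + \<i> * of_real t * inverse (of_real a)) ^ N :: complex)"
    using pole_nonzero[of _ a] by (intro continuous_intros) (auto simp: divide_inverse)
  thus ?thesis
    by (simp add: pole_kernel_def[abs_def] divide_inverse)
qed

lemma borel_measurable_pole_kernel [measurable]: "pole_kernel a N \<in> borel_measurable borel"
  by (intro borel_measurable_continuous_onI continuous_on_pole_kernel)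

lemma DERIV_reciprocal_power:
  fixes g :: "'a :: real_normed_field \<Rightarrow> 'a"
  assumes g: "(g has_field_derivative g') (at z)" and nz: "g z \<noteq> 0"
  shows "((\<lambda>z. 1 / g z ^ N) has_field_derivative - (of_nat N * g' * (1 / g z ^ Suc N))) (at z)"
proof (cases N)
  case (Suc M)
  show ?thesis
    unfolding Suc using nz
    by (intro DERIV_cong[OF DERIV_divide[OF DERIV_const DERIV_power_Suc[OF g]]]) (auto simp: field_simps)
qed auto

text \<open>Integration by parts: the derivative of \<open>exp (- x * t) * pole_kernel a N t\<close>
  is integrated over the half line, where only the boundary value 1 at \<open>t = 0\<close>
  remains.\<close>

lemma pole_laplace_rec:
  assumes x: "x > 0" and a: "a > 0"
  shows "of_real x * pole_laplace a N x = 1 - \<i> * of_nat N / of_real a * pole_laplace a (Suc N) x"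
proof -
  define F where "F = (\<lambda>t. of_real (exp (- x * t)) * pole_kernel a N t)"
  define f where "f = (\<lambda>t. - (of_real x * (of_real (exp (- x * t)) * pole_kernel a N t)
      + \<i> * of_nat N / of_real a * (of_real (exp (- x * t)) * pole_kernel a (Suc N) t)))"
  have int: "integrable lborel (\<lambda>t. (indicator {0..} t * (t ^ 0 * exp (- x * t))) *\<^sub>R pole_kernel a M t)" for M
    by (rule integrable_laplace_moment[where M = 1]) (use x norm_pole_kernel_le_1 in auto)
  have f: "indicator {0..} t *\<^sub>R f t =
      - (of_real x * ((indicator {0..} t * (t ^ 0 * exp (- x * t))) *\<^sub>R pole_kernel a N t) +
         \<i> * of_nat N / of_real a * ((indicator {0..} t * (t ^ 0 * exp (- x * t))) *\<^sub>R pole_kernel a (Suc N) t))" for t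
    unfolding f_def by (simp add: scaleR_conv_of_real algebra_simps)
  have "(\<integral>t. indicator {0..} t *\<^sub>R f t \<partial>lborel) = - F 0"
  proof (rule integral_FTC_at_top)
    fix t
    \<comment> \<open>The product is differentiated as a function of a complex variable at a real
      point; restricting to the real line then gives the vector derivative.\<close>
    have "((\<lambda>z. exp (- of_real x * z) * (1 / (1 + \<i> * z / of_real a) ^ N)) has_field_derivative f t) (at (of_real t))"
    proof -
      have "((\<lambda>z. 1 + \<i> * z / of_real a :: complex) has_field_derivative \<i> / of_real a) (at (of_real t))"
        using a by (auto intro!: derivative_eq_intros)
      from DERIV_reciprocal_power[OF this pole_nonzero, of N]
      have "((\<lambda>z. 1 / (1 + \<i> * z / of_real a) ^ N) has_field_derivative
          - (of_nat N * (\<i> / of_real a) * pole_kernel a (Suc N) t)) (at (of_real t))"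
        by (simp add: pole_kernel_def)
      moreover have "((\<lambda>z. exp (- of_real x * z)) has_field_derivative
          - of_real x * of_real (exp (- x * t))) (at (of_real t :: complex))"
        by (auto intro!: derivative_eq_intros simp: exp_of_real[symmetric])
      ultimately have "((\<lambda>z. exp (- of_real x * z) * (1 / (1 + \<i> * z / of_real a) ^ N)) has_field_derivative
          (- of_real x * of_real (exp (- x * t))) * (1 / (1 + \<i> * of_real t / of_real a) ^ N)
          + - (of_nat N * (\<i> / of_real a) * pole_kernel a (Suc N) t) * exp (- of_real x * of_real t)) (at (of_real t))"
        by (intro DERIV_mult)
      thus ?thesis
        by (rule DERIV_cong) (simp add: f_def pole_kernel_def exp_of_real[symmetric] algebra_simps)
    qed
    from has_vector_derivative_real_field[OF this]
    show "(F has_vector_derivative f t) (at t)"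
      unfolding F_def pole_kernel_def by (simp add: exp_of_real[symmetric])
  next
    show "continuous_on UNIV f"
      unfolding f_def by (intro continuous_intros continuous_on_pole_kernel)
    show "integrable lborel (\<lambda>t. indicator {0..} t *\<^sub>R f t)"
      unfolding f by (intro integrable_minus Bochner_Integration.integrable_add integrable_mult_right int)
    show "(F \<longlongrightarrow> 0) at_top"
    proof (rule Lim_null_comparison)
      show "\<forall>\<^sub>F t in at_top. norm (F t) \<le> exp (- x * t)"
        using norm_pole_kernel_le_1[of a N]
        by (intro always_eventually allI) (auto simp: F_def norm_mult intro: mult_left_le)
      show "((\<lambda>t. exp (- x * t)) \<longlongrightarrow> 0) at_top"
        using x by real_asymp
    qed
  qed
  moreover have "(\<integral>t. indicator {0..} t *\<^sub>R f t \<partial>lborel) =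
      - (of_real x * pole_laplace a N x + \<i> * of_nat N / of_real a * pole_laplace a (Suc N) x)"
    unfolding f pole_laplace_def laplace_moment_def
    by (subst integral_minus, subst Bochner_Integration.integral_add)
       (intro integrable_mult_right int, intro integrable_mult_right int, simp only: integral_mult_right_zero)
  moreover have "F 0 = 1"
    by (simp add: F_def pole_kernel_def)
  ultimately show ?thesis
    by (simp add: algebra_simps)
qed

lemma norm_pole_laplace_le: "x > 0 \<Longrightarrow> norm (pole_laplace a N x) \<le> 1 / x"
  unfolding pole_laplace_def
  using norm_laplace_moment_le[of "pole_kernel a N" 1 x 0] norm_pole_kernel_le_1 by simp

text \<open>Solving the recursion for the transform of index \<open>Suc N\<close> gives a bound
  that, unlike \<open>1 / x\<close>, stays finite as \<open>x\<close> tends to 0. It later controls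
  the transform of the density near 0.\<close>

lemma norm_pole_laplace_Suc_le:
  assumes x: "x > 0" and a: "a > 0" and N: "N > 0"
  shows "norm (pole_laplace a (Suc N) x) \<le> 2 * a"
proof -
  have "\<i> * of_nat N / of_real a * pole_laplace a (Suc N) x = 1 - of_real x * pole_laplace a N x"
    using pole_laplace_rec[OF x a, of N] by (simp add: algebra_simps)
  hence "real N / a * norm (pole_laplace a (Suc N) x) = norm (1 - of_real x * pole_laplace a N x)"
    using a by (metis (no_types, lifting) norm_mult norm_divide norm_ii norm_of_nat norm_of_real abs_of_pos mult_1)
  also have "\<dots> \<le> 1 + x * norm (pole_laplace a N x)"
    using norm_triangle_ineq4[of 1 "of_real x * pole_laplace a N x"] x by (simp add: norm_mult)
  also have "x * norm (pole_laplace a N x) \<le> 1"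
    using norm_pole_laplace_le[OF x, of a N] x by (simp add: field_simps)
  finally have "real N * norm (pole_laplace a (Suc N) x) \<le> 2 * a"
    using a by (simp add: field_simps)
  moreover have "1 * norm (pole_laplace a (Suc N) x) \<le> real N * norm (pole_laplace a (Suc N) x)"
    using N by (intro mult_right_mono) auto
  ultimately show ?thesis
    by simp
qed

lemma laplace_moment_Re_pole_kernel:
  assumes "x > 0"
  shows "laplace_moment (\<lambda>t. Re (pole_kernel a N t)) 0 x = Re (pole_laplace a N x)"
proof -
  have "integrable lborel (\<lambda>t. (indicator {0..} t * (t ^ 0 * exp (- x * t))) *\<^sub>R pole_kernel a N t)"
    by (rule integrable_laplace_moment[where M = 1]) (use assms norm_pole_kernel_le_1 in auto)
  from integral_Re[OF this] show ?thesis
    by (simp add: pole_laplace_def laplace_moment_def)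
qed

text \<open>After two steps of the recursion the coefficient of the new transform is real, since the
  two factors \<open>\<i>\<close> multiply to -1, and the boundary term of the second step is purely
  imaginary. Hence the real parts satisfy a recursion of their own.\<close>

lemma Re_pole_laplace_rec2:
  assumes x: "x > 0" and a: "a > 0"
  shows "x\<^sup>2 * Re (pole_laplace a (2 * p + 1) x) =
    x - (2 * p + 1) * (2 * p + 2) / a\<^sup>2 * Re (pole_laplace a (2 * p + 3) x)"
proof -
  have "of_real (x\<^sup>2) * pole_laplace a (2 * p + 1) x =
      of_real x * (1 - \<i> * of_nat (2 * p + 1) / of_real a * pole_laplace a (Suc (2 * p + 1)) x)"
    by (subst pole_laplace_rec[OF x a, symmetric]) (simp add: power2_eq_square)
  also have "\<dots> = of_real x - \<i> * of_nat (2 * p + 1) / of_real a * (of_real x * pole_laplace a (Suc (2 * p + 1)) x)"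
    by (simp add: algebra_simps)
  also have "\<dots> = of_real x - \<i> * of_nat (2 * p + 1) / of_real a *
      (1 - \<i> * of_nat (Suc (2 * p + 1)) / of_real a * pole_laplace a (Suc (Suc (2 * p + 1))) x)"
    by (subst pole_laplace_rec[OF x a]) simp
  also have "\<dots> = of_real x - \<i> * of_real (real (2 * p + 1) / a) -
      of_real (real (2 * p + 1) * real (2 * p + 2) / a\<^sup>2) * pole_laplace a (2 * p + 3) x"
  proof -
    \<comment> \<open>The algebra is done for a generic \<open>u\<close>; only afterwards is
      \<open>u\<close> set to \<open>\<i>\<close>, where \<open>u\<^sup>2\<close> becomes
      -1.\<close>
    have "u * of_nat (2 * p + 1) / of_real a * (1 - u * of_nat (2 * p + 2) / of_real a * z)
      = u * of_real (real (2 * p + 1) / a) - u\<^sup>2 * of_real (real (2 * p + 1) * real (2 * p + 2) / a\<^sup>2) * z" for u z :: complex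
      using a by (simp add: field_simps power2_eq_square)
    from this[of \<i>] show ?thesis
      by (simp add: eval_nat_numeral)
  qed
  finally have eq: "of_real (x\<^sup>2) * pole_laplace a (2 * p + 1) x = \<dots>" .
  from arg_cong[OF eq, of Re] show ?thesis
    by (simp add: add.commute)
qed

text \<open>Iterates the two-step recursion. Summed over all poles, the polynomial part becomes
  \<open>x ^ (2 * p)\<close> times the first \<open>p\<close> terms of the Stirling series.\<close>

lemma Re_pole_laplace_expansion:
  assumes x: "x > 0" and a: "a > 0"
  shows "x ^ (2 * p) * Re (pole_laplace a 1 x) =
    (\<Sum>i<p. (-1) ^ i * fact (2 * i) / a ^ (2 * i) * x ^ (2 * (p - Suc i) + 1)) +
    (-1) ^ p * fact (2 * p) / a ^ (2 * p) * Re (pole_laplace a (2 * p + 1) x)"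
proof (induction p)
  case (Suc p)
  have "x ^ (2 * Suc p) * Re (pole_laplace a 1 x) = x\<^sup>2 * (x ^ (2 * p) * Re (pole_laplace a 1 x))"
    by (simp add: power2_eq_square)
  also have "\<dots> = (\<Sum>i<p. (-1) ^ i * fact (2 * i) / a ^ (2 * i) * (x\<^sup>2 * x ^ (2 * (p - Suc i) + 1))) +
      (-1) ^ p * fact (2 * p) / a ^ (2 * p) * (x\<^sup>2 * Re (pole_laplace a (2 * p + 1) x))"
    unfolding Suc.IH by (simp add: ring_distribs sum_distrib_left mult_ac)
  also have "(\<Sum>i<p. (-1) ^ i * fact (2 * i) / a ^ (2 * i) * (x\<^sup>2 * x ^ (2 * (p - Suc i) + 1))) =
      (\<Sum>i<p. (-1) ^ i * fact (2 * i) / a ^ (2 * i) * x ^ (2 * (Suc p - Suc i) + 1))"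
  proof (intro sum.cong refl)
    fix i assume "i \<in> {..<p}"
    hence "2 * (Suc p - Suc i) + 1 = 2 + (2 * (p - Suc i) + 1)"
      by auto
    hence "x\<^sup>2 * x ^ (2 * (p - Suc i) + 1) = x ^ (2 * (Suc p - Suc i) + 1)"
      by (simp only: power_add)
    thus "(-1) ^ i * fact (2 * i) / a ^ (2 * i) * (x\<^sup>2 * x ^ (2 * (p - Suc i) + 1)) =
          (-1) ^ i * fact (2 * i) / a ^ (2 * i) * x ^ (2 * (Suc p - Suc i) + 1)"
      by simp
  qed
  also have "(-1) ^ p * fact (2 * p) / a ^ (2 * p) * (x\<^sup>2 * Re (pole_laplace a (2 * p + 1) x)) =
      (-1) ^ p * fact (2 * p) / a ^ (2 * p) * x +
      (-1) ^ Suc p * fact (2 * Suc p) / a ^ (2 * Suc p) * Re (pole_laplace a (2 * Suc p + 1) x)"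
    unfolding Re_pole_laplace_rec2[OF x a] using a
    by (simp add: field_simps power2_eq_square eval_nat_numeral)
  finally show ?case
    by simp
qed simp

lemma Re_pole_kernel_1:
  assumes "a > 0"
  shows "2 / a\<^sup>2 * Re (pole_kernel a 1 t) = 2 / (t\<^sup>2 + a\<^sup>2)"
  using assms by (simp add: pole_kernel_def Re_divide field_simps power2_eq_square)

section \<open>Completely monotonic functions\<close>

lemma completely_monotonic_on_cong:
  assumes "\<And>x. x \<in> I \<Longrightarrow> f x = g x"
  shows "completely_monotonic_on I f \<longleftrightarrow> completely_monotonic_on I g"
proof -
  have "completely_monotonic_on I h'" if "completely_monotonic_on I h" "\<And>x. x \<in> I \<Longrightarrow> h x = h' x" for h h'
  proof -
    from that(1) obtain D where "\<forall>x\<in>I. D 0 x = h x"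
        "\<forall>k. \<forall>x\<in>I. (D k has_real_derivative D (Suc k) x) (at x within I)"
        "\<forall>k. \<forall>x\<in>I. (-1) ^ k * D k x \<ge> 0"
      unfolding completely_monotonic_on_def by blast
    thus ?thesis
      unfolding completely_monotonic_on_def using that(2) by (intro exI[of _ D]) metis
  qed
  from this[of f g] this[of g f] assms show ?thesis
    by metis
qed

text \<open>Complete monotonicity only asserts that some sequence of derivatives exists. On an open
  set such a sequence is determined by its first member, so sign conditions on the unknown sequence
  transfer to an explicit one.\<close>

lemma derivative_sequence_unique:
  fixes D E :: "nat \<Rightarrow> real \<Rightarrow> real"
  assumes "open S"
    and D: "\<And>k x. x \<in> S \<Longrightarrow> (D k has_real_derivative D (Suc k) x) (at x within S)"
    and E: "\<And>k x. x \<in> S \<Longrightarrow> (E k has_real_derivative E (Suc k) x) (at x within S)"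
    and "\<And>x. x \<in> S \<Longrightarrow> D 0 x = E 0 x" and "x \<in> S"
  shows "D k x = E k x"
  using \<open>x \<in> S\<close>
proof (induction k arbitrary: x)
  case (Suc k)
  have "(D k has_real_derivative D (Suc k) x) (at x)"
    using D[OF Suc.prems, of k] by (simp only: at_within_open[OF Suc.prems \<open>open S\<close>])
  hence "(E k has_real_derivative D (Suc k) x) (at x)"
    by (rule has_field_derivative_transform_within_open[OF _ \<open>open S\<close> Suc.prems Suc.IH])
  moreover have "(E k has_real_derivative E (Suc k) x) (at x)"
    using E[OF Suc.prems, of k] by (simp only: at_within_open[OF Suc.prems \<open>open S\<close>])
  ultimately show ?case
    by (rule DERIV_unique)
qed (use assms in auto)

lemma leibniz_has_real_derivative:
  fixes F G :: "nat \<Rightarrow> real \<Rightarrow> real"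
  assumes F: "\<And>k. (F k has_real_derivative F (Suc k) x) (at x within S)"
    and G: "\<And>k. (G k has_real_derivative G (Suc k) x) (at x within S)"
  shows "((\<lambda>x. \<Sum>i\<le>n. real (n choose i) * (F i x * G (n - i) x)) has_real_derivative
      (\<Sum>i\<le>Suc n. real (Suc n choose i) * (F i x * G (Suc n - i) x))) (at x within S)"
proof -
  have "((\<lambda>x. \<Sum>i\<le>n. real (n choose i) * (F i x * G (n - i) x)) has_real_derivative
      (\<Sum>i\<le>n. real (n choose i) * (F (Suc i) x * G (n - i) x + G (Suc (n - i)) x * F i x))) (at x within S)"
    by (intro DERIV_sum DERIV_cmult DERIV_mult F G)
  also have "(\<Sum>i\<le>n. real (n choose i) * (F (Suc i) x * G (n - i) x + G (Suc (n - i)) x * F i x)) =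
      (\<Sum>i\<le>n. real (n choose i) * (F (Suc i) x * G (Suc n - Suc i) x)) +
      (\<Sum>i\<le>n. real (n choose i) * (F i x * G (Suc n - i) x))"
    unfolding sum.distrib[symmetric] by (intro sum.cong refl) (auto simp: algebra_simps Suc_diff_le)
  \<comment> \<open>The added term \<open>i = Suc n\<close> carries the binomial coefficient
    \<open>n choose Suc n = 0\<close>; with it both sums can be aligned and merged by Pascal's
    rule.\<close>
  also have "(\<Sum>i\<le>n. real (n choose i) * (F i x * G (Suc n - i) x)) =
      (\<Sum>i\<le>Suc n. real (n choose i) * (F i x * G (Suc n - i) x))"
    by simp
  also have "\<dots> = F 0 x * G (Suc n) x + (\<Sum>i\<le>n. real (n choose Suc i) * (F (Suc i) x * G (Suc n - Suc i) x))"
    by (subst sum.atMost_Suc_shift) simp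
  also have "(\<Sum>i\<le>n. real (n choose i) * (F (Suc i) x * G (Suc n - Suc i) x)) + \<dots> =
      (\<Sum>i\<le>Suc n. real (Suc n choose i) * (F i x * G (Suc n - i) x))"
    by (subst sum.atMost_Suc_shift) (simp add: sum.distrib algebra_simps)
  finally show ?thesis .
qed

text \<open>In Leibniz' formula the sign \<open>(-1) ^ k\<close> splits as
  \<open>(-1) ^ i * (-1) ^ (k - i)\<close>, so every summand becomes a product of nonnegative
  factors.\<close>

lemma completely_monotonic_on_mult:
  assumes "completely_monotonic_on I f" "completely_monotonic_on I g"
  shows "completely_monotonic_on I (\<lambda>x. f x * g x)"
proof -
  from assms(1) obtain F where
    F: "\<And>x. x \<in> I \<Longrightarrow> F 0 x = f x" "\<And>k x. x \<in> I \<Longrightarrow> (F k has_real_derivative F (Suc k) x) (at x within I)"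
       "\<And>k x. x \<in> I \<Longrightarrow> (-1) ^ k * F k x \<ge> 0"
    unfolding completely_monotonic_on_def by blast
  from assms(2) obtain G where
    G: "\<And>x. x \<in> I \<Longrightarrow> G 0 x = g x" "\<And>k x. x \<in> I \<Longrightarrow> (G k has_real_derivative G (Suc k) x) (at x within I)"
       "\<And>k x. x \<in> I \<Longrightarrow> (-1) ^ k * G k x \<ge> 0"
    unfolding completely_monotonic_on_def by blast
  show ?thesis
    unfolding completely_monotonic_on_def
  proof (intro exI conjI ballI allI)
    fix k x assume x: "x \<in> I"
    show "((\<lambda>x. \<Sum>i\<le>k. real (k choose i) * (F i x * G (k - i) x)) has_real_derivative
      (\<Sum>i\<le>Suc k. real (Suc k choose i) * (F i x * G (Suc k - i) x))) (at x within I)"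
      by (intro leibniz_has_real_derivative F G x)
    have "(-1) ^ k * (\<Sum>i\<le>k. real (k choose i) * (F i x * G (k - i) x)) =
        (\<Sum>i\<le>k. real (k choose i) * (((-1) ^ i * F i x) * ((-1) ^ (k - i) * G (k - i) x)))"
      unfolding sum_distrib_left
    proof (intro sum.cong refl)
      fix i assume "i \<in> {..k}"
      hence "(-1 :: real) ^ k = (-1) ^ i * (-1) ^ (k - i)"
        by (simp flip: power_add)
      thus "(-1) ^ k * (real (k choose i) * (F i x * G (k - i) x)) =
          real (k choose i) * (((-1) ^ i * F i x) * ((-1) ^ (k - i) * G (k - i) x))"
        by (simp only: mult_ac)
    qed
    also have "\<dots> \<ge> 0"
      by (intro sum_nonneg mult_nonneg_nonneg[OF of_nat_0_le_iff mult_nonneg_nonneg] F G x)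
    finally show "0 \<le> (-1) ^ k * (\<Sum>i\<le>k. real (k choose i) * (F i x * G (k - i) x))" .
  qed (use F G in simp)
qed

section \<open>Real powers and the set of admissible exponents\<close>

definition powr_deriv :: "real \<Rightarrow> nat \<Rightarrow> real \<Rightarrow> real" where
  "powr_deriv r k x = (\<Prod>i<k. r - real i) * x powr (r - real k)"

lemma has_real_derivative_powr_deriv:
  "x > 0 \<Longrightarrow> (powr_deriv r k has_real_derivative powr_deriv r (Suc k) x) (at x within A)"
  unfolding powr_deriv_def[abs_def]
  by (auto intro!: derivative_eq_intros simp: algebra_simps)

lemma completely_monotonic_on_powr_minus:
  assumes "s \<ge> 0"
  shows "completely_monotonic_on {0<..} (\<lambda>x. x powr - s)"
  unfolding completely_monotonic_on_def
proof (intro exI conjI ballI allI)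
  fix k and x :: real assume "x \<in> {0<..}"
  thus "(powr_deriv (- s) k has_real_derivative powr_deriv (- s) (Suc k) x) (at x within {0<..})"
    by (intro has_real_derivative_powr_deriv) auto
  have "(-1) ^ k * (\<Prod>i<k. - s - real i) = (\<Prod>i<k. s + real i)"
    by (induction k) (auto simp: algebra_simps)
  hence "(-1) ^ k * powr_deriv (- s) k x = (\<Prod>i<k. s + real i) * x powr (- s - real k)"
    by (simp add: powr_deriv_def flip: mult.assoc)
  also have "\<dots> \<ge> 0"
    using assms by (intro mult_nonneg_nonneg prod_nonneg) auto
  finally show "0 \<le> (-1) ^ k * powr_deriv (- s) k x" .
qed (simp add: powr_deriv_def)

text \<open>Leibniz' formula for the k-th derivative of \<open>x powr r * f x\<close>, where
  \<open>D\<close> lists the derivatives of \<open>f\<close>. In this explicit form the dependence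
  on \<open>r\<close> is visibly continuous for fixed \<open>x > 0\<close>.\<close>

definition powr_times_deriv :: "(nat \<Rightarrow> real \<Rightarrow> real) \<Rightarrow> real \<Rightarrow> nat \<Rightarrow> real \<Rightarrow> real" where
  "powr_times_deriv D r k x = (\<Sum>i\<le>k. real (k choose i) * (powr_deriv r i x * D (k - i) x))"

text \<open>Replaces the existential over derivative sequences by inequalities between functions
  continuous in \<open>r\<close>. This is what makes the set of admissible exponents closed.\<close>

lemma completely_monotonic_powr_times_iff:
  assumes D0: "\<And>x. x > 0 \<Longrightarrow> D 0 x = f x"
    and D: "\<And>k x. x > 0 \<Longrightarrow> (D k has_real_derivative D (Suc k) x) (at x within {0<..})"
  shows "completely_monotonic_on {0<..} (\<lambda>x. x powr r * f x) \<longleftrightarrow>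
    (\<forall>k. \<forall>x\<in>{0<..}. (-1) ^ k * powr_times_deriv D r k x \<ge> 0)" (is "?lhs \<longleftrightarrow> ?rhs")
proof -
  have W: "(powr_times_deriv D r k has_real_derivative powr_times_deriv D r (Suc k) x) (at x within {0<..})"
    if "x \<in> {0<..}" for k x
    unfolding powr_times_deriv_def[abs_def] using that
    by (intro leibniz_has_real_derivative has_real_derivative_powr_deriv D) auto
  have W0: "powr_times_deriv D r 0 x = x powr r * f x" if "x \<in> {0<..}" for x
    using that D0 by (simp add: powr_times_deriv_def powr_deriv_def)
  show ?thesis
  proof
    assume ?lhs
    then obtain E where E: "\<And>x. x \<in> {0<..} \<Longrightarrow> E 0 x = x powr r * f x"
      "\<And>k x. x \<in> {0<..} \<Longrightarrow> (E k has_real_derivative E (Suc k) x) (at x within {0<..})"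
      "\<And>k x. x \<in> {0<..} \<Longrightarrow> (-1) ^ k * E k x \<ge> 0"
      unfolding completely_monotonic_on_def by blast
    have "E k x = powr_times_deriv D r k x" if "x \<in> {0<..}" for k x
      by (rule derivative_sequence_unique[where S = "{0<..}"]) (use that E(1,2) W W0 in auto)
    thus ?rhs
      using E(3) by metis
  next
    assume ?rhs
    thus ?lhs
      unfolding completely_monotonic_on_def using W W0 by blast
  qed
qed

text \<open>Multiplying by a negative power of \<open>x\<close> preserves complete monotonicity, so
  the admissible exponents \<open>q \<ge> 0\<close> are downward closed. They also form a closed set
  bounded by \<open>s\<close>, hence an interval from 0 to an attained supremum, the degree. As the
  supremum is admissible and \<open>s\<close> is not, the upper bound is strict.\<close>

lemma cm_degree_bounds:
  assumes f: "completely_monotonic_on {0<..} f"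
    and L: "Lim at_top f = 0"
    and r: "r \<ge> 0" "completely_monotonic_on {0<..} (\<lambda>x. x powr r * f x)"
    and s: "s \<ge> 0" "\<not> completely_monotonic_on {0<..} (\<lambda>x. x powr s * f x)"
  shows "has_cm_degree f (cm_degree f)" "r \<le> cm_degree f" "cm_degree f < s"
proof -
  from f obtain D where "\<forall>x\<in>{0<..}. D 0 x = f x"
      "\<forall>k. \<forall>x\<in>{0<..}. (D k has_real_derivative D (Suc k) x) (at x within {0<..})"
    unfolding completely_monotonic_on_def by blast
  hence D0: "\<And>x. x > 0 \<Longrightarrow> D 0 x = f x"
    and D: "\<And>k x. x > 0 \<Longrightarrow> (D k has_real_derivative D (Suc k) x) (at x within {0<..})"
    by auto
  \<comment> \<open>\<open>S\<close> is closed because every derivative of \<open>x powr q * f x\<close> is continuous in \<open>q\<close>.\<close>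
  define S where "S = {q \<in> {0..}. completely_monotonic_on {0<..} (\<lambda>x. x powr q * f x)}"
  have "S = {0..} \<inter> (\<Inter>k. \<Inter>x\<in>{0<..}. {q. (-1) ^ k * powr_times_deriv D q k x \<ge> 0})"
    unfolding S_def using completely_monotonic_powr_times_iff[where D = D and f = f, OF D0 D] by auto
  moreover have "closed {q. (-1) ^ k * powr_times_deriv D q k x \<ge> 0}" if "x > 0" for k x
    unfolding powr_times_deriv_def powr_deriv_def using that
    by (intro closed_Collect_le continuous_intros) auto
  ultimately have "closed S"
    by (auto intro!: closed_Int closed_INT)
  have down: "q' \<in> S" if q: "q \<in> S" "0 \<le> q'" "q' \<le> q" for q q'
  proof -
    have "completely_monotonic_on {0<..} (\<lambda>x. x powr - (q - q') * (x powr q * f x))"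
      using q by (intro completely_monotonic_on_mult[OF completely_monotonic_on_powr_minus]) (simp_all add: S_def)
    also have "?this \<longleftrightarrow> completely_monotonic_on {0<..} (\<lambda>x. x powr q' * f x)"
      by (intro completely_monotonic_on_cong) (auto simp flip: mult.assoc powr_add)
    finally show ?thesis
      using q by (simp add: S_def)
  qed
  have "r \<in> S" "s \<notin> S"
    using r s by (auto simp: S_def)
  have below: "q < s" if "q \<in> S" for q
    using down[OF that s(1)] \<open>s \<notin> S\<close> by force
  hence "bdd_above S"
    by (intro bdd_aboveI[of _ s]) (auto intro: less_imp_le)
  define \<alpha> where "\<alpha> = Sup S"
  have "\<alpha> \<in> S"
    unfolding \<alpha>_def using \<open>r \<in> S\<close> \<open>bdd_above S\<close> \<open>closed S\<close> by (intro closed_contains_Sup) auto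
  have S_iff: "q \<in> S \<longleftrightarrow> q \<le> \<alpha>" if "q \<ge> 0" for q
    using down[OF \<open>\<alpha> \<in> S\<close> that] cSup_upper[OF _ \<open>bdd_above S\<close>, of q] by (auto simp: \<alpha>_def)
  have degree_iff: "has_cm_degree f \<beta> \<longleftrightarrow> (\<forall>q\<ge>0. q \<in> S \<longleftrightarrow> q \<le> \<beta>)" for \<beta>
    using f by (auto simp: has_cm_degree_def L S_def)
  have "has_cm_degree f \<alpha>"
    using S_iff by (simp add: degree_iff)
  moreover have "\<beta> = \<alpha>" if "has_cm_degree f \<beta>" for \<beta>
  proof -
    \<comment> \<open>The equivalence is available only for nonnegative exponents, so it is applied
      to \<open>\<alpha>\<close> first; this shows that \<open>\<beta>\<close> is nonnegative
      too.\<close>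
    have iff: "q \<le> \<alpha> \<longleftrightarrow> q \<le> \<beta>" if "q \<ge> 0" for q
      using S_iff[OF that] \<open>has_cm_degree f \<beta>\<close> that by (simp add: degree_iff)
    have "\<alpha> \<ge> 0"
      using \<open>\<alpha> \<in> S\<close> by (simp add: S_def)
    with iff[of \<alpha>] have "\<alpha> \<le> \<beta>"
      by simp
    with \<open>\<alpha> \<ge> 0\<close> iff[of \<beta>] show ?thesis
      by simp
  qed
  ultimately have "cm_degree f = \<alpha>"
    unfolding cm_degree_def by (intro the_equality)
  thus "has_cm_degree f (cm_degree f)" "r \<le> cm_degree f" "cm_degree f < s"
    using \<open>has_cm_degree f \<alpha>\<close> S_iff[OF r(1)] \<open>r \<in> S\<close> below[OF \<open>\<alpha> \<in> S\<close>] by auto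
qed

section \<open>Complete monotonicity of Laplace transforms and a converse\<close>

lemma laplace_moment_nonneg:
  fixes f :: "real \<Rightarrow> real"
  assumes "\<And>t. t \<ge> 0 \<Longrightarrow> f t \<ge> 0"
  shows "laplace_moment f k x \<ge> 0"
  unfolding laplace_moment_def
  by (intro Bochner_Integration.integral_nonneg) (auto simp: indicator_def assms)

text \<open>The easy direction of Bernstein's theorem: the k-th derivative is
  \<open>(-1) ^ k\<close> times a moment of a nonnegative function.\<close>

lemma completely_monotonic_laplace:
  fixes f :: "real \<Rightarrow> real"
  assumes "f \<in> borel_measurable borel" "\<And>t. t \<ge> 0 \<Longrightarrow> 0 \<le> f t" "\<And>t. t \<ge> 0 \<Longrightarrow> f t \<le> M"
  shows "completely_monotonic_on {0<..} (laplace_moment f 0)"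
proof -
  have bound: "\<bar>f t\<bar> \<le> M" if "t \<ge> 0" for t
    using assms(2,3)[OF that] by simp
  show ?thesis
    unfolding completely_monotonic_on_def
  proof (intro exI conjI ballI allI)
    fix k and x :: real assume "x \<in> {0<..}"
    hence "(laplace_moment f k has_real_derivative - laplace_moment f (Suc k) x) (at x within {0<..})"
      by (intro has_field_derivative_at_within[OF has_real_derivative_laplace_moment[OF assms(1) bound]]) auto
    from DERIV_cmult[OF this, of "(-1) ^ k"]
    show "((\<lambda>x. (-1) ^ k * laplace_moment f k x) has_real_derivative
        (-1) ^ Suc k * laplace_moment f (Suc k) x) (at x within {0<..})"
      by simp
    show "0 \<le> (-1) ^ k * ((-1) ^ k * laplace_moment f k x)"
      using laplace_moment_nonneg[OF assms(2)] by (simp flip: mult.assoc power_mult_distrib)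
  qed simp
qed

text \<open>
  For \<open>H x = C - x * L P x\<close>, the terms \<open>(-x)\<^sup>j / j! * H\<^sup>(\<^sup>j\<^sup>) x\<close> telescope, and complete monotonicity bounds the
  Taylor polynomial of \<open>H\<close> about \<open>x\<close>, evaluated at \<open>0\<close>, by \<open>H (0+) = C\<close>. Together this gives
  \<open>laplace_moment P k x \<ge> 0\<close>.
\<close>
lemma completely_monotonic_imp_nonneg_density:
  fixes P :: "real \<Rightarrow> real"
  assumes P: "P \<in> borel_measurable borel" "\<And>t. t \<ge> 0 \<Longrightarrow> \<bar>P t\<bar> \<le> M" "isCont P s" "s > 0"
    and lim: "((\<lambda>x. x * laplace_moment P 0 x) \<longlongrightarrow> 0) (at_right 0)"
    and cm: "completely_monotonic_on {0<..} (\<lambda>x. C - x * laplace_moment P 0 x)"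
  shows "P s \<ge> 0"
proof (rule laplace_moment_nonneg_imp_nonneg[OF P])
  fix k and x :: real assume x: "x > 0"
  let ?L = "laplace_moment P"
  \<comment> \<open>The explicit derivatives of \<open>C - x * ?L 0 x\<close>, obtained from the
    product rule and the fact that the derivative of \<open>?L i\<close> is
    \<open>- ?L (Suc i)\<close>.\<close>
  define E where "E = (\<lambda>j x. case j of 0 \<Rightarrow> C - x * ?L 0 x
    | Suc i \<Rightarrow> (-1) ^ Suc i * (real (Suc i) * ?L i x - x * ?L (Suc i) x))"
  have L: "(?L j has_real_derivative - ?L (Suc j) y) (at y within A)" if "y > 0" for j y A
    by (rule has_field_derivative_at_within[OF has_real_derivative_laplace_moment[OF P(1,2) that]])
  have E_deriv: "(E j has_real_derivative E (Suc j) y) (at y within A)" if "y > 0" for j y A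
    unfolding E_def using that
    by (cases j) (auto intro!: derivative_eq_intros L simp: algebra_simps)
  obtain D where D: "\<And>x. x \<in> {0<..} \<Longrightarrow> D 0 x = C - x * ?L 0 x"
      "\<And>k x. x \<in> {0<..} \<Longrightarrow> (D k has_real_derivative D (Suc k) x) (at x within {0<..})"
      "\<And>k x. x \<in> {0<..} \<Longrightarrow> (-1) ^ k * D k x \<ge> 0"
    using cm unfolding completely_monotonic_on_def by blast
  have E_sign: "(-1) ^ j * E j y \<ge> 0" if "y > 0" for j y
  proof -
    have "D j y = E j y"
      by (rule derivative_sequence_unique[where S = "{0<..}"]) (use that D(1,2) E_deriv in \<open>auto simp: E_def\<close>)
    thus ?thesis
      using D(3)[of y j] that by simp
  qed
  have taylor: "(\<Sum>j<Suc k. (-1) ^ j * E j x / fact j * (x - y) ^ j) \<le> C - y * ?L 0 y" if y: "0 < y" "y < x" for y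
  proof -
    have "\<exists>t. y < t \<and> t < x \<and> E 0 y = (\<Sum>j<Suc k. E j x / fact j * (y - x) ^ j) + E (Suc k) t / fact (Suc k) * (y - x) ^ Suc k"
      using y by (intro Taylor_down[where b = x]) (auto intro!: E_deriv)
    then obtain t where t: "y < t"
      "E 0 y = (\<Sum>j<Suc k. E j x / fact j * (y - x) ^ j) + E (Suc k) t / fact (Suc k) * (y - x) ^ Suc k"
      by blast
    have flip_sign: "c / fact j * (y - x) ^ j = (-1) ^ j * c / fact j * (x - y) ^ j" for c and j :: nat
      using power_mult_distrib[of "-1" "x - y" j] by simp
    \<comment> \<open>This is the Lagrange remainder: the sign of \<open>E (Suc k) t\<close> cancels
      that of \<open>(y - x) ^ Suc k\<close>, so the Taylor polynomial lies below the
      function.\<close>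
    have "0 \<le> (-1) ^ Suc k * E (Suc k) t / fact (Suc k) * (x - y) ^ Suc k"
      using t(1) y by (intro mult_nonneg_nonneg divide_nonneg_nonneg E_sign) auto
    hence "(\<Sum>j<Suc k. (-1) ^ j * E j x / fact j * (x - y) ^ j) \<le> E 0 y"
      unfolding t(2) flip_sign by linarith
    thus ?thesis
      by (simp add: E_def)
  qed
  have telescope: "(\<Sum>j<Suc k. (-1) ^ j * E j x / fact j * x ^ j) = C - x ^ Suc k * ?L k x / fact k"
  proof (induction k)
    case (Suc k)
    have "(-1) ^ Suc k * E (Suc k) x / fact (Suc k) * x ^ Suc k =
        (real (Suc k) * ?L k x - x * ?L (Suc k) x) / fact (Suc k) * x ^ Suc k"
      by (simp add: E_def flip: mult.assoc power_mult_distrib)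
    also have "\<dots> = x ^ Suc k * ?L k x / fact k - x ^ Suc (Suc k) * ?L (Suc k) x / fact (Suc k)"
      by (simp add: field_simps del: of_nat_Suc)
    finally show ?case
      using Suc.IH by (subst sum.lessThan_Suc) simp
  qed (simp add: E_def)
  have "(\<Sum>j<Suc k. (-1) ^ j * E j x / fact j * (x - 0) ^ j) \<le> C - 0"
  proof (rule tendsto_le)
    show "((\<lambda>y. \<Sum>j<Suc k. (-1) ^ j * E j x / fact j * (x - y) ^ j) \<longlongrightarrow>
        (\<Sum>j<Suc k. (-1) ^ j * E j x / fact j * (x - 0) ^ j)) (at_right 0)"
      by (intro tendsto_intros)
    show "((\<lambda>y. C - y * ?L 0 y) \<longlongrightarrow> C - 0) (at_right 0)"
      by (intro tendsto_intros lim)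
    show "\<forall>\<^sub>F y in at_right 0. (\<Sum>j<Suc k. (-1) ^ j * E j x / fact j * (x - y) ^ j) \<le> C - y * ?L 0 y"
      using eventually_at_right_less[of 0] x taylor
      by (auto simp: eventually_at_right_field intro!: exI[of _ x])
  qed auto
  hence "x ^ Suc k / fact k * 0 \<le> x ^ Suc k / fact k * ?L k x"
    using telescope by (simp del: power_Suc)
  thus "?L k x \<ge> 0"
    using x by (subst (asm) mult_le_cancel_left_pos) (simp_all del: power_Suc)
qed

section \<open>Partial fractions and Bernoulli numbers\<close>

text \<open>The nonzero poles of \<open>t / (exp t - 1)\<close> are
  \<open>\<i> * coth_pole m\<close> and their conjugates. The shift by one makes the index start at
  0.\<close>

definition coth_pole :: "nat \<Rightarrow> real" where
  "coth_pole m = 2 * pi * real (Suc m)"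

lemma coth_pole_pos [simp]: "coth_pole m > 0"
  by (simp add: coth_pole_def)

lemma coth_pole_nonzero [simp]: "coth_pole m \<noteq> 0"
  using coth_pole_pos[of m] by linarith

lemma coth_pole_ge_1: "coth_pole m \<ge> 1"
proof -
  have "1 * 1 \<le> (2 * pi) * real (Suc m)"
    using pi_gt3 by (intro mult_mono) auto
  thus ?thesis
    by (simp add: coth_pole_def)
qed

lemma summable_coth_pole: "p \<ge> 2 \<Longrightarrow> summable (\<lambda>m. 2 / coth_pole m ^ p)"
proof -
  assume "p \<ge> 2"
  hence "summable (\<lambda>m. inverse (real (Suc m) ^ p))"
    using inverse_power_summable[of p, where ?'a = real] by (subst summable_Suc_iff)
  hence "summable (\<lambda>m. 2 / (2 * pi) ^ p * inverse (real (Suc m) ^ p))"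
    by (rule summable_mult)
  thus ?thesis
    by (simp add: coth_pole_def power_mult_distrib divide_inverse mult_ac del: of_nat_Suc)
qed

text \<open>Euler's product for the sine, evaluated at the imaginary point
  \<open>\<i> * t / (2 * pi)\<close>.\<close>

lemma sinh_product_formula:
  fixes t :: real
  shows "(\<lambda>n. t / 2 * (\<Prod>m<n. 1 + t\<^sup>2 / coth_pole m ^ 2)) \<longlonglongrightarrow> sinh (t / 2)"
proof -
  let ?z = "\<i> * complex_of_real (t / (2 * pi))"
  have "(\<lambda>n. of_real pi * ?z * (\<Prod>k=1..n. 1 - ?z\<^sup>2 / (of_nat k)\<^sup>2)) \<longlonglongrightarrow> sin (of_real pi * ?z)"
    by (rule sin_product_formula_complex)
  also have "(\<lambda>n. of_real pi * ?z * (\<Prod>k=1..n. 1 - ?z\<^sup>2 / (of_nat k)\<^sup>2)) =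
      (\<lambda>n. \<i> * of_real (t / 2 * (\<Prod>m<n. 1 + t\<^sup>2 / coth_pole m ^ 2)))"
  proof
    fix n
    have "(\<Prod>k=1..n. 1 - ?z\<^sup>2 / (of_nat k)\<^sup>2) = (\<Prod>m<n. 1 - ?z\<^sup>2 / (of_nat (Suc m))\<^sup>2)"
      by (rule prod.reindex_bij_witness[of _ Suc "\<lambda>k. k - 1"]) auto
    also have "\<dots> = of_real (\<Prod>m<n. 1 + t\<^sup>2 / coth_pole m ^ 2)"
      unfolding of_real_prod
      by (intro prod.cong refl) (simp add: coth_pole_def power_mult_distrib power_divide)
    finally show "of_real pi * ?z * (\<Prod>k=1..n. 1 - ?z\<^sup>2 / (of_nat k)\<^sup>2) =
        \<i> * of_real (t / 2 * (\<Prod>m<n. 1 + t\<^sup>2 / coth_pole m ^ 2))"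
      by simp
  qed
  also have "sin (of_real pi * ?z) = \<i> * of_real (sinh (t / 2))"
  proof -
    have "of_real pi * ?z = \<i> * of_real (t / 2)"
      by simp
    moreover have "sin (\<i> * of_real (t / 2)) = \<i> * sinh (of_real (t / 2) :: complex)"
      by (simp add: sinh_conv_sin)
    moreover have "sinh (of_real (t / 2) :: complex) = of_real (sinh (t / 2))"
      by (simp add: sinh_field_def flip: exp_of_real)
    ultimately show ?thesis
      by metis
  qed
  finally have "(\<lambda>n. Im (\<i> * of_real (t / 2 * (\<Prod>m<n. 1 + t\<^sup>2 / coth_pole m ^ 2)))) \<longlonglongrightarrow>
      Im (\<i> * of_real (sinh (t / 2)))"
    by (rule tendsto_Im)
  thus ?thesis
    by (simp only: Im_i_times Re_complex_of_real)
qed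

lemma ln_sinh_sums:
  fixes t :: real
  assumes t: "t > 0"
  shows "(\<lambda>m. ln (1 + t\<^sup>2 / coth_pole m ^ 2)) sums (ln (sinh (t / 2)) - ln (t / 2))"
proof -
  have pos: "1 + t\<^sup>2 / coth_pole m ^ 2 > 0" for m
    by (intro add_pos_nonneg) auto
  have "(\<lambda>n. ln (t / 2 * (\<Prod>m<n. 1 + t\<^sup>2 / coth_pole m ^ 2))) \<longlonglongrightarrow> ln (sinh (t / 2))"
    using t by (intro tendsto_ln sinh_product_formula) auto
  moreover have "ln (t / 2 * (\<Prod>m<n. 1 + t\<^sup>2 / coth_pole m ^ 2)) =
      ln (t / 2) + (\<Sum>m<n. ln (1 + t\<^sup>2 / coth_pole m ^ 2))" for n
    using t pos by (subst ln_mult_pos) (auto intro!: prod_pos ln_prod simp: pos less_imp_neq[OF pos, symmetric])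
  ultimately have "(\<lambda>n. ln (t / 2) + (\<Sum>m<n. ln (1 + t\<^sup>2 / coth_pole m ^ 2)) - ln (t / 2)) \<longlonglongrightarrow>
      ln (sinh (t / 2)) - ln (t / 2)"
    by (intro tendsto_diff tendsto_const) auto
  thus ?thesis
    by (simp add: sums_def)
qed

text \<open>The logarithmic derivative of the product for \<open>sinh (t / 2)\<close>, multiplied by
  \<open>t\<close>; the right-hand side is \<open>t / 2 * coth (t / 2) - 1\<close> in exponential
  form. The Weierstrass test on the bounded interval \<open>?S\<close> justifies differentiating
  term by term.\<close>

lemma coth_partial_fractions:
  fixes t :: real
  assumes t: "t > 0"
  shows "(\<lambda>m. 2 * t\<^sup>2 / (t\<^sup>2 + coth_pole m ^ 2)) sums (t / (exp t - 1) - 1 + t / 2)"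
proof -
  define f' where "f' = (\<lambda>m t. 2 * t / (t\<^sup>2 + coth_pole m ^ 2))"
  let ?S = "{0<..<2 * t}"
  have denom: "s\<^sup>2 + coth_pole m ^ 2 > 0" for s m
    by (intro add_nonneg_pos) auto
  have bound: "norm (f' m s) \<le> 2 * t * (2 / coth_pole m ^ 2)" if "s \<in> ?S" for m s
  proof -
    have "norm (f' m s) = 2 * s / (s\<^sup>2 + coth_pole m ^ 2)"
      using that denom[of s m] by (auto simp: f'_def)
    also have "\<dots> \<le> 4 * t / coth_pole m ^ 2"
      using that by (intro frac_le) auto
    finally show ?thesis
      by simp
  qed
  have summ: "summable (\<lambda>m. 2 * t * (2 / coth_pole m ^ 2))"
    by (intro summable_mult summable_coth_pole) auto
  have deriv: "((\<lambda>s. \<Sum>m. ln (1 + s\<^sup>2 / coth_pole m ^ 2)) has_field_derivative (\<Sum>m. f' m t)) (at t)"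
  proof (rule has_field_derivative_series'(2)[of ?S])
    show "((\<lambda>s. ln (1 + s\<^sup>2 / coth_pole m ^ 2)) has_field_derivative f' m s) (at s within ?S)" for m s
    proof -
      define c where "c = coth_pole m ^ 2"
      have c: "c > 0" "1 + s\<^sup>2 / c > 0"
        by (auto simp: c_def intro!: add_pos_nonneg)
      have "((\<lambda>s. 1 + s\<^sup>2 / c) has_field_derivative 2 * s / c) (at s within ?S)"
        using c(1) by (auto intro!: derivative_eq_intros)
      hence "((\<lambda>s. ln (1 + s\<^sup>2 / c)) has_field_derivative 1 / (1 + s\<^sup>2 / c) * (2 * s / c)) (at s within ?S)"
        by (intro DERIV_chain2[where f = ln] DERIV_ln_divide c)
      moreover have "1 + s\<^sup>2 / c = (s\<^sup>2 + c) / c"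
        using c(1) by (simp add: field_simps)
      ultimately show ?thesis
        using c(1) by (simp add: f'_def c_def)
    qed
    show "uniformly_convergent_on ?S (\<lambda>n s. \<Sum>i<n. f' i s)"
      by (rule Weierstrass_m_test'[OF bound summ])
    show "summable (\<lambda>m. ln (1 + t\<^sup>2 / coth_pole m ^ 2))"
      using ln_sinh_sums[OF t] by (rule sums_summable)
  qed (use t in auto)
  have "((\<lambda>s. ln (sinh (s / 2)) - ln (s / 2)) has_field_derivative (\<Sum>m. f' m t)) (at t)"
    using deriv
  proof (rule has_field_derivative_transform_within_open)
    show "(\<Sum>m. ln (1 + s\<^sup>2 / coth_pole m ^ 2)) = ln (sinh (s / 2)) - ln (s / 2)" if "s \<in> {0<..}" for s
      using ln_sinh_sums[of s] that by (simp add: sums_iff)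
  qed (use t in auto)
  moreover have "((\<lambda>s. ln (sinh (s / 2)) - ln (s / 2)) has_field_derivative
      cosh (t / 2) / (2 * sinh (t / 2)) - 1 / t) (at t)"
    using t by (auto intro!: derivative_eq_intros simp: field_simps)
  ultimately have suminf: "(\<Sum>m. f' m t) = cosh (t / 2) / (2 * sinh (t / 2)) - 1 / t"
    by (rule DERIV_unique)
  have "summable (\<lambda>m. f' m t)"
    using t by (intro summable_comparison_test'[OF summ, of 0] bound) auto
  hence "(\<lambda>m. f' m t) sums (cosh (t / 2) / (2 * sinh (t / 2)) - 1 / t)"
    using suminf by (simp add: sums_iff)
  hence "(\<lambda>m. t * f' m t) sums (t * (cosh (t / 2) / (2 * sinh (t / 2)) - 1 / t))"
    by (rule sums_mult)
  also have "(\<lambda>m. t * f' m t) = (\<lambda>m. 2 * t\<^sup>2 / (t\<^sup>2 + coth_pole m ^ 2))"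
    by (simp add: f'_def power2_eq_square mult_ac)
  also have "t * (cosh (t / 2) / (2 * sinh (t / 2)) - 1 / t) = t / (exp t - 1) - 1 + t / 2"
  proof -
    define e where "e = exp (t / 2)"
    have e: "e > 1" "exp t = e * e"
      using t by (simp_all add: e_def flip: exp_add)
    have e2: "e * e > 1"
      using e(1) less_1_mult by blast
    have cosh_sinh: "cosh (t / 2) = (e + 1 / e) / 2" "sinh (t / 2) = (e - 1 / e) / 2"
      unfolding cosh_field_def sinh_field_def e_def exp_minus inverse_eq_divide by (rule refl)+
    have "cosh (t / 2) / (2 * sinh (t / 2)) = (e + 1 / e) / (2 * (e - 1 / e))"
    proof -
      have "u / 2 / (2 * (v / 2)) = u / (2 * v)" for u v :: real
        by simp
      thus ?thesis
        unfolding cosh_sinh .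
    qed
    also have "\<dots> = 1 / (e * e - 1) + 1 / 2"
      using e(1) e2 by (simp add: field_simps)
    finally show ?thesis
      using t by (simp add: e(2) field_simps)
  qed
  finally show ?thesis .
qed

section \<open>Power series coefficients and even Bernoulli numbers\<close>

definition coth_tail :: "nat \<Rightarrow> real \<Rightarrow> real" where
  "coth_tail n t = (\<Sum>m. 2 / (coth_pole m ^ (2 * n) * (t\<^sup>2 + coth_pole m ^ 2)))"

text \<open>In terms of the zeta function this is 2 zeta(2n + 2) / (2 pi)^(2n + 2).\<close>

definition coth_coeff :: "nat \<Rightarrow> real" where
  "coth_coeff n = (\<Sum>m. 2 / coth_pole m ^ (2 * n + 2))"

lemma coth_tail_term:
  "0 \<le> 2 / (coth_pole m ^ (2 * n) * (t\<^sup>2 + coth_pole m ^ 2))"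
  "2 / (coth_pole m ^ (2 * n) * (t\<^sup>2 + coth_pole m ^ 2)) \<le> 2 / coth_pole m ^ 2"
proof -
  have "coth_pole m ^ 2 > 0"
    by simp
  hence "t\<^sup>2 + coth_pole m ^ 2 > 0"
    by (intro add_nonneg_pos) auto
  thus "0 \<le> 2 / (coth_pole m ^ (2 * n) * (t\<^sup>2 + coth_pole m ^ 2))"
    by (intro divide_nonneg_nonneg mult_nonneg_nonneg) (auto simp: less_imp_le)
  have "1 * coth_pole m ^ 2 \<le> coth_pole m ^ (2 * n) * (t\<^sup>2 + coth_pole m ^ 2)"
    using coth_pole_ge_1[of m] by (intro mult_mono one_le_power) auto
  thus "2 / (coth_pole m ^ (2 * n) * (t\<^sup>2 + coth_pole m ^ 2)) \<le> 2 / coth_pole m ^ 2"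
    by (intro divide_left_mono) (auto intro!: mult_pos_pos add_nonneg_pos)
qed

lemma summable_coth_tail: "summable (\<lambda>m. 2 / (coth_pole m ^ (2 * n) * (t\<^sup>2 + coth_pole m ^ 2)))"
  by (rule summable_comparison_test'[OF summable_coth_pole[of 2], of 0]) (use coth_tail_term in auto)

lemma coth_tail_bounds: "0 \<le> coth_tail n t" "coth_tail n t \<le> coth_coeff 0"
proof -
  have "coth_coeff 0 = (\<Sum>m. 2 / coth_pole m ^ 2)"
    by (simp add: coth_coeff_def numeral_2_eq_2)
  thus "0 \<le> coth_tail n t" "coth_tail n t \<le> coth_coeff 0"
    unfolding coth_tail_def
    by (auto intro!: suminf_nonneg suminf_le coth_tail_term summable_coth_tail summable_coth_pole simp del: power_Suc)
qed

text \<open>One step of the geometric series in each term: with \<open>D = t\<^sup>2 + C\<close>,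
  one has \<open>1 / D = 1 / C - t\<^sup>2 / (C * D)\<close>. Iterating it expands
  \<open>coth_tail 0\<close> in powers of \<open>t\<^sup>2\<close> with an exact remainder.\<close>

lemma coth_tail_rec: "coth_tail n t = coth_coeff n - t\<^sup>2 * coth_tail (Suc n) t"
proof -
  have "2 / (coth_pole m ^ (2 * n) * (t\<^sup>2 + coth_pole m ^ 2)) =
      2 / coth_pole m ^ (2 * n + 2) - t\<^sup>2 * (2 / (coth_pole m ^ (2 * Suc n) * (t\<^sup>2 + coth_pole m ^ 2)))" for m
  proof -
    have "2 / (u * D) = 2 / (u * C) - (D - C) * (2 / (u * C * D))"
      if "u \<noteq> 0" "C \<noteq> 0" "D \<noteq> 0" for u C D :: real
      using that by (simp add: field_simps)
    note identity = this[of "coth_pole m ^ (2 * n)" "coth_pole m ^ 2" "t\<^sup>2 + coth_pole m ^ 2"]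
    have "t\<^sup>2 + coth_pole m ^ 2 > 0"
      by (intro add_nonneg_pos) auto
    with identity show ?thesis
      by (simp add: power_add power2_eq_square mult_ac)
  qed
  hence "(\<lambda>m. 2 / (coth_pole m ^ (2 * n) * (t\<^sup>2 + coth_pole m ^ 2))) sums
      (coth_coeff n - t\<^sup>2 * coth_tail (Suc n) t)"
    unfolding coth_tail_def coth_coeff_def
    by (simp only:) (intro sums_diff sums_mult summable_sums summable_coth_tail summable_coth_pole, simp)
  thus ?thesis
    by (simp add: coth_tail_def sums_iff)
qed

lemma coth_tail_expansion:
  "coth_tail 0 t = (\<Sum>k<n. (-1) ^ k * coth_coeff k * t ^ (2 * k)) + (-1) ^ n * t ^ (2 * n) * coth_tail n t"
proof (induction n)
  case (Suc n)
  thus ?case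
    by (simp add: coth_tail_rec[of n] algebra_simps power2_eq_square)
qed simp

lemma coth_tail_0:
  assumes "t > 0"
  shows "t\<^sup>2 * coth_tail 0 t = t / (exp t - 1) - 1 + t / 2"
proof -
  have "t\<^sup>2 * coth_tail 0 t = (\<Sum>m. t\<^sup>2 * (2 / (coth_pole m ^ (2 * 0) * (t\<^sup>2 + coth_pole m ^ 2))))"
    unfolding coth_tail_def by (rule suminf_mult[OF summable_coth_tail, symmetric])
  also have "\<dots> = t / (exp t - 1) - 1 + t / 2"
    using coth_partial_fractions[OF assms] by (simp add: sums_iff mult_ac)
  finally show ?thesis .
qed

text \<open>Euler's evaluation of the even zeta values. For \<open>0 < t < 1\<close> both sides are
  coefficients of series in \<open>t\<^sup>2\<close> with sum \<open>coth_tail 0 t\<close>: one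
  comes from the generating function, the other from the partial fractions. The difference series
  vanishes on an interval, so its coefficients are zero.\<close>

lemma bernoulli_even_eq_coth_coeff:
  "bernoulli (2 * (k + 1)) / fact (2 * (k + 1)) = (-1) ^ k * coth_coeff k"
proof -
  define d where "d = (\<lambda>k. bernoulli (2 * (k + 1)) / fact (2 * (k + 1)) - (-1) ^ k * coth_coeff k)"
  have sums_0: "(\<lambda>k. d k * (t\<^sup>2) ^ k) sums 0" if t: "t > 0" "t < 1" for t :: real
  proof -
    have "(\<lambda>k. of_real (bernoulli (2 * (k + 1)) / fact (2 * (k + 1))) * complex_of_real t ^ (2 * (k + 1)))
             sums (of_real t / (exp (of_real t) - 1) - (1 - of_real t / 2))"
      by (rule bernoulli_even_sums) (use t pi_gt3 in auto)
    hence "(\<lambda>k. complex_of_real (bernoulli (2 * (k + 1)) / fact (2 * (k + 1)) * t ^ (2 * (k + 1))))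
             sums of_real (t / (exp t - 1) - 1 + t / 2)"
      by (simp add: exp_of_real diff_diff_eq2 diff_add_eq)
    hence *: "(\<lambda>k. bernoulli (2 * (k + 1)) / fact (2 * (k + 1)) * t ^ (2 * (k + 1))) sums (t\<^sup>2 * coth_tail 0 t)"
      unfolding sums_of_real_iff coth_tail_0[OF t(1)] .
    have 1: "(\<lambda>k. bernoulli (2 * (k + 1)) / fact (2 * (k + 1)) * (t\<^sup>2) ^ k) sums coth_tail 0 t"
    proof -
      have "1 / t\<^sup>2 * (B * t ^ (2 * (k + 1))) = B * (t\<^sup>2) ^ k" for B and k :: nat
      proof -
        have "t ^ (2 * (k + 1)) = t\<^sup>2 ^ (k + 1)"
          by (rule power_mult)
        thus ?thesis
          using t by simp
      qed
      with sums_mult[OF *, of "1 / t\<^sup>2"] show ?thesis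
        using t by (simp only:) simp
    qed
    have "(\<lambda>n. (\<Sum>k<n. (-1) ^ k * coth_coeff k * (t\<^sup>2) ^ k) - coth_tail 0 t) \<longlonglongrightarrow> 0"
    proof (rule Lim_null_comparison)
      show "\<forall>\<^sub>F n in sequentially. norm ((\<Sum>k<n. (-1) ^ k * coth_coeff k * (t\<^sup>2) ^ k) - coth_tail 0 t)
          \<le> (t\<^sup>2) ^ n * coth_coeff 0"
      proof (intro always_eventually allI)
        fix n
        have "(\<Sum>k<n. (-1) ^ k * coth_coeff k * (t\<^sup>2) ^ k) - coth_tail 0 t = - ((-1) ^ n * (t\<^sup>2) ^ n * coth_tail n t)"
          by (subst coth_tail_expansion[of t n]) (simp add: power_mult)
        also have "norm \<dots> = (t\<^sup>2) ^ n * coth_tail n t"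
          using coth_tail_bounds[of n t] by (simp add: abs_mult power_abs)
        also have "\<dots> \<le> (t\<^sup>2) ^ n * coth_coeff 0"
          by (intro mult_left_mono coth_tail_bounds) auto
        finally show "norm ((\<Sum>k<n. (-1) ^ k * coth_coeff k * (t\<^sup>2) ^ k) - coth_tail 0 t)
          \<le> (t\<^sup>2) ^ n * coth_coeff 0" .
      qed
      have "(\<lambda>n. (t\<^sup>2) ^ n * coth_coeff 0) \<longlonglongrightarrow> 0 * coth_coeff 0"
        using t by (intro tendsto_intros LIMSEQ_power_zero) (auto simp: power_less_one_iff)
      thus "(\<lambda>n. (t\<^sup>2) ^ n * coth_coeff 0) \<longlonglongrightarrow> 0"
        by simp
    qed
    hence 2: "(\<lambda>k. (-1) ^ k * coth_coeff k * (t\<^sup>2) ^ k) sums coth_tail 0 t"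
      unfolding sums_def by (rule LIM_zero_cancel)
    from sums_diff[OF 1 2] show ?thesis
      by (simp add: d_def algebra_simps)
  qed
  have zero: "(\<lambda>k. d k * s ^ k) sums 0" if "s > 0" "s < 1" for s
    using sums_0[of "sqrt s"] that by simp
  have summ: "summable (\<lambda>k. d k * s ^ k)" if "norm s < 1" for s
  proof -
    define u where "u = (norm s + 1) / 2"
    have u: "norm s < u" "u < 1"
      using that by (simp_all add: u_def)
    have "u > 0"
      using u(1) norm_ge_zero[of s] by linarith
    show ?thesis
      by (rule powser_inside[of d u]) (use u \<open>u > 0\<close> zero[of u] in \<open>auto simp: sums_iff\<close>)
  qed
  have "d k = 0"
  proof (rule ccontr)
    assume "d k \<noteq> 0"
    \<comment> \<open>Multiplying the series by \<open>s\<close> makes it vanish at 0 and moves the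
      nonzero coefficient to the positive index \<open>Suc k\<close>, the setting in which zeros of
      a power series are isolated.\<close>
    define a where "a = (\<lambda>n. case n of 0 \<Rightarrow> 0 | Suc k \<Rightarrow> d k)"
    define f where "f = (\<lambda>s. s * (\<Sum>k. d k * s ^ k))"
    have "(\<lambda>n. a n * (s - 0) ^ n) sums f s" if "norm (s - 0) < 1" for s
    proof -
      have "(\<lambda>k. s * (d k * s ^ k)) sums f s"
        unfolding f_def using that by (intro sums_mult summable_sums summ) auto
      hence "(\<lambda>k. a (Suc k) * s ^ Suc k) sums f s"
        by (simp add: a_def mult_ac)
      thus ?thesis
        by (subst (asm) sums_Suc_iff) (simp add: a_def)
    qed
    then obtain r where r: "r > 0" "\<And>s. s \<in> cball 0 r - {0} \<Longrightarrow> f s \<noteq> 0"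
      by (rule powser_0_nonzero[rotated, of 0 1 a f "Suc k"]) (use \<open>d k \<noteq> 0\<close> in \<open>auto simp: a_def f_def\<close>)
    have "f (min r (1 / 2)) = 0"
      using zero[of "min r (1 / 2)"] r(1) by (simp add: f_def sums_iff)
    moreover have "min r (1 / 2) \<in> cball 0 r - {0}"
      using r(1) by auto
    ultimately show False
      using r(2) by blast
  qed
  thus ?thesis
    by (simp add: d_def)
qed

section \<open>Binet's formula\<close>

lemma borel_measurable_coth_tail [measurable]: "coth_tail n \<in> borel_measurable borel"
  unfolding coth_tail_def by measurable

lemma abs_coth_tail_le: "\<bar>coth_tail n t\<bar> \<le> coth_coeff 0"
  using coth_tail_bounds[of n t] by simp

text \<open>Binet's function, the bracket of \<open>gamma_remainder\<close> without the Bernoulli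
  sum.\<close>

definition binet :: "real \<Rightarrow> real" where
  "binet x = ln (Gamma x) - (x - 1 / 2) * ln x + x - 1 / 2 * ln (2 * pi)"

text \<open>The factor \<open>t\<^sup>2\<close> turns \<open>coth_tail 0 t\<close> into
  \<open>t / (exp t - 1) - 1 + t / 2\<close>. Expanding the first term geometrically and integrating
  gives the trigamma series without its first term \<open>1 / x\<^sup>2\<close>; the other two are
  elementary transforms.\<close>

lemma laplace_moment_2_coth_tail:
  assumes x: "x > 0"
  shows "laplace_moment (coth_tail 0) 2 x = Polygamma 1 x - 1 / x - 1 / (2 * x\<^sup>2)"
proof -
  let ?w = "\<lambda>k x t. indicator {0..} t * (t ^ k * exp (- x * t)) :: real"
  have xk: "x + real (Suc k) > 0" for k
    using x by simp
  have geom: "(\<lambda>k. ?w 1 (x + real (Suc k)) t) sums (?w 0 x t * (t / (exp t - 1)))" if t: "t > 0" for t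
  proof -
    have "(\<lambda>k. exp (- t) ^ k) sums (1 / (1 - exp (- t)))"
      using t by (intro geometric_sums) auto
    from sums_mult[OF this, of "t * exp (- x * t) * exp (- t)"]
    have "(\<lambda>k. t * exp (- x * t) * exp (- t) * exp (- t) ^ k) sums
        (t * exp (- x * t) * exp (- t) * (1 / (1 - exp (- t))))" .
    moreover have "t * exp (- x * t) * exp (- t) * exp (- t) ^ k = ?w 1 (x + real (Suc k)) t" for k
      using t by (simp add: algebra_simps flip: exp_add exp_of_nat_mult)
    moreover have "t * exp (- x * t) * exp (- t) * (1 / (1 - exp (- t))) = ?w 0 x t * (t / (exp t - 1))"
    proof -
      have "exp (- t) * (1 / (1 - exp (- t))) = 1 / (exp t - 1)"
        using t by (simp add: exp_minus field_simps)
      hence "t * exp (- x * t) * (exp (- t) * (1 / (1 - exp (- t)))) = t * exp (- x * t) * (1 / (exp t - 1))"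
        by (simp only:)
      thus ?thesis
        using t by (simp add: mult_ac)
    qed
    ultimately show ?thesis
      by (simp only:)
  qed
  have geom_sums: "\<exists>s. (\<lambda>k. ?w 1 (x + real (Suc k)) t) sums s" for t
  proof (cases "t > 0")
    case True
    thus ?thesis
      using geom by blast
  next
    case False
    hence "(\<lambda>k. ?w 1 (x + real (Suc k)) t) = (\<lambda>k. 0)"
      by (auto simp: indicator_def)
    thus ?thesis
      using sums_zero by metis
  qed
  have psums: "(\<lambda>k. 1 / (x + real (Suc k))\<^sup>2) sums (Polygamma 1 x - 1 / x\<^sup>2)"
  proof -
    have "(\<lambda>k. 1 / (x + real k)\<^sup>2) sums Polygamma 1 x"
      using Polygamma_LIMSEQ[of x 1] x by (simp add: numeral_2_eq_2 inverse_eq_divide)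
    hence "(\<lambda>k. 1 / (x + real (Suc k))\<^sup>2) sums (Polygamma 1 x - 1 / (x + real 0)\<^sup>2)"
      by (subst sums_Suc_iff) simp
    thus ?thesis
      by simp
  qed
  have int: "integrable lborel (\<lambda>t. ?w 1 (x + real (Suc k)) t)" for k
    by (rule integrable_power_exp[OF xk])
  have val: "(\<integral>t. ?w 1 (x + real (Suc k)) t \<partial>lborel) = 1 / (x + real (Suc k))\<^sup>2" for k
    by (subst integral_power_exp[OF xk]) (simp add: power2_eq_square)
  have nonneg: "?w 1 y t \<ge> 0" for y t
    by (simp add: indicator_def)
  have "(\<lambda>k. \<integral>t. ?w 1 (x + real (Suc k)) t \<partial>lborel) sums (\<integral>t. (\<Sum>k. ?w 1 (x + real (Suc k)) t) \<partial>lborel)"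
  proof (rule sums_integral[OF int])
    show "AE t in lborel. summable (\<lambda>k. norm (?w 1 (x + real (Suc k)) t))"
      using geom_sums nonneg by (simp only: real_norm_def abs_of_nonneg summable_def) simp
    show "summable (\<lambda>k. \<integral>t. norm (?w 1 (x + real (Suc k)) t) \<partial>lborel)"
      using psums nonneg by (simp only: real_norm_def abs_of_nonneg val sums_iff)
  qed
  hence "(\<integral>t. (\<Sum>k. ?w 1 (x + real (Suc k)) t) \<partial>lborel) = Polygamma 1 x - 1 / x\<^sup>2"
    unfolding val using psums by (rule sums_unique2)
  also have "(\<integral>t. (\<Sum>k. ?w 1 (x + real (Suc k)) t) \<partial>lborel) =
      (\<integral>t. ?w 2 x t *\<^sub>R coth_tail 0 t + ?w 0 x t - 1 / 2 * ?w 1 x t \<partial>lborel)"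
  proof (rule integral_cong_AE)
    \<comment> \<open>At \<open>t = 0\<close> the two integrands differ, since
      \<open>?w 0 x 0 = 1\<close>; this single point is a null set. For negative \<open>t\<close>
      all weights vanish.\<close>
    show "AE t in lborel. (\<Sum>k. ?w 1 (x + real (Suc k)) t) = ?w 2 x t *\<^sub>R coth_tail 0 t + ?w 0 x t - 1 / 2 * ?w 1 x t"
      using AE_lborel_singleton[of 0]
    proof eventually_elim
      case (elim t)
      show ?case
      proof (cases "t > 0")
        case True
        have "(\<Sum>k. ?w 1 (x + real (Suc k)) t) = ?w 0 x t * (t / (exp t - 1))"
          using geom[OF True] by (simp only: sums_iff)
        also have "t / (exp t - 1) = t\<^sup>2 * coth_tail 0 t + 1 - t / 2"
          using coth_tail_0[OF True] by simp
        finally show ?thesis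
          by (simp add: algebra_simps)
      next
        case False
        with elim show ?thesis
          by simp
      qed
    qed
  qed measurable
  also have "\<dots> = laplace_moment (coth_tail 0) 2 x + 1 / x - 1 / 2 * (1 / x\<^sup>2)"
  proof -
    have "integrable lborel (\<lambda>t. ?w 2 x t *\<^sub>R coth_tail 0 t)"
      by (rule integrable_laplace_moment[where M = "coth_coeff 0"]) (use x abs_coth_tail_le in auto)
    moreover have "has_bochner_integral lborel (?w 0 x) (1 / x)" "has_bochner_integral lborel (?w 1 x) (1 / x\<^sup>2)"
      using has_bochner_integral_power_exp[OF x, of 0] has_bochner_integral_power_exp[OF x, of 1]
      by (simp_all add: power2_eq_square)
    ultimately have "has_bochner_integral lborel (\<lambda>t. ?w 2 x t *\<^sub>R coth_tail 0 t + ?w 0 x t - 1 / 2 * ?w 1 x t)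
        (laplace_moment (coth_tail 0) 2 x + 1 / x - 1 / 2 * (1 / x\<^sup>2))"
      unfolding laplace_moment_def
      by (intro has_bochner_integral_add has_bochner_integral_diff has_bochner_integral_mult_right
            has_bochner_integral_integrable)
    thus ?thesis
      by (rule has_bochner_integral_integral_eq)
  qed
  finally show ?thesis
    by (simp add: field_simps)
qed

lemma Gamma_legendre_duplication_real:
  assumes "y > 0"
  shows "Gamma y * Gamma (y + 1 / 2) = exp ((1 - 2 * y) * ln 2) * sqrt pi * Gamma (2 * y)"
proof -
  have "complex_of_real y \<notin> \<int>\<^sub>\<le>\<^sub>0" "complex_of_real y + 1 / 2 \<notin> \<int>\<^sub>\<le>\<^sub>0"
    using assms by (auto elim!: nonpos_Ints_cases simp: complex_eq_iff)
  from Gamma_legendre_duplication[OF this]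
  have "Gamma (complex_of_real y) * Gamma (complex_of_real (y + 1 / 2)) =
      exp (complex_of_real ((1 - 2 * y) * ln 2)) * complex_of_real (sqrt pi) * Gamma (complex_of_real (2 * y))"
    by simp
  hence "complex_of_real (Gamma y * Gamma (y + 1 / 2)) =
      complex_of_real (exp ((1 - 2 * y) * ln 2) * sqrt pi * Gamma (2 * y))"
    unfolding Gamma_complex_of_real exp_of_real by (simp only: of_real_mult)
  thus ?thesis
    by (simp only: of_real_eq_iff)
qed

text \<open>
  Both sides have the same second derivative, so they differ by an affine function; the step
  \<open>x \<mapsto> x + 1\<close> and the duplication formula show that it vanishes.
\<close>
lemma binet_eq_laplace:
  assumes x: "x > 0"
  shows "binet x = laplace_moment (coth_tail 0) 0 x"
proof -
  let ?L = "laplace_moment (coth_tail 0)"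
  define d where "d = (\<lambda>x. binet x - ?L 0 x)"
  define d' where "d' = (\<lambda>x. Digamma x - ln x + 1 / (2 * x) + ?L 1 x)"
  have L: "(?L k has_real_derivative - ?L (Suc k) y) (at y within A)" if "y > 0" for k y A
    by (rule has_field_derivative_at_within[OF has_real_derivative_laplace_moment[OF _ abs_coth_tail_le that]]) simp
  define g where "g = (\<lambda>y :: real. ln (Gamma y))"
  have nonpos: "y \<notin> \<int>\<^sub>\<le>\<^sub>0" if "y > 0" for y :: real
    using that by (auto elim!: nonpos_Ints_cases)
  have g: "(g has_real_derivative Digamma y) (at y within A)" if "y > 0" for y A
    unfolding g_def
  proof (rule has_field_derivative_at_within, rule has_field_derivative_transform_within_open)
    show "(ln_Gamma has_real_derivative Digamma y) (at y)"
      using that by (auto intro!: derivative_eq_intros)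
    show "ln_Gamma z = ln (Gamma z)" if "z \<in> {0<..}" for z :: real
      using that by (intro ln_Gamma_real_pos) auto
  qed (use that in auto)
  have d: "(d has_real_derivative d' y) (at y within {0<..})" if "y > 0" for y
    unfolding d_def binet_def d'_def g_def[symmetric, THEN fun_cong] using that
    by (auto intro!: derivative_eq_intros g L simp: field_simps)
  have d': "(d' has_real_derivative 0) (at y within {0<..})" if "y > 0" for y
  proof -
    have "(d' has_real_derivative Polygamma (Suc 0) y - 1 / y - 1 / (2 * y\<^sup>2) - ?L (Suc 1) y) (at y within {0<..})"
      unfolding d'_def using that nonpos[OF that]
      by (auto intro!: derivative_eq_intros L simp: field_simps power2_eq_square)
    also have "?L (Suc 1) y = Polygamma 1 y - 1 / y - 1 / (2 * y\<^sup>2)"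
      using laplace_moment_2_coth_tail[OF that] by (simp add: numeral_2_eq_2)
    finally show ?thesis
      by simp
  qed
  obtain B where B: "d' y = B" if "y > 0" for y
    using has_field_derivative_zero_constant[of "{0<..}" d'] d' by auto
  have "((\<lambda>y. d y - B * y) has_real_derivative 0) (at y within {0<..})" if "y > 0" for y
    using d[OF that] B[OF that] by (auto intro!: derivative_eq_intros)
  then obtain A where A: "d y - B * y = A" if "y > 0" for y
    using has_field_derivative_zero_constant[of "{0<..}" "\<lambda>y. d y - B * y"] by auto
  have L_lim: "(?L 0 \<longlongrightarrow> 0) at_top"
  proof (rule Lim_null_comparison)
    show "\<forall>\<^sub>F y in at_top. norm (?L 0 y) \<le> coth_coeff 0 / y"
      using eventually_gt_at_top[of 0]
    proof eventually_elim
      case (elim y)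
      thus ?case
        using norm_laplace_moment_le[of "coth_tail 0" "coth_coeff 0" y 0] abs_coth_tail_le by simp
    qed
    show "((\<lambda>y. coth_coeff 0 / y) \<longlongrightarrow> 0) at_top"
      by real_asymp
  qed
  have L_lim': "((\<lambda>y. ?L 0 (y + c)) \<longlongrightarrow> 0) at_top" "((\<lambda>y. ?L 0 (2 * y)) \<longlongrightarrow> 0) at_top" for c
    by (rule filterlim_compose[OF L_lim], real_asymp)+
  have "B = 0"
  proof -
    \<comment> \<open>By the functional equation, \<open>1 - (y + 1 / 2) * ln (1 + 1 / y)\<close> is
      \<open>binet (y + 1) - binet y\<close>, so the whole expression is
      \<open>d (y + 1) - d y\<close>, the slope \<open>B\<close>.\<close>
    have "((\<lambda>y. 1 - (y + 1 / 2) * ln (1 + 1 / y) - (?L 0 (y + 1) - ?L 0 y)) \<longlongrightarrow> 0 - (0 - 0)) at_top"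
      by (intro tendsto_diff L_lim L_lim') real_asymp
    moreover have "\<forall>\<^sub>F y in at_top. 1 - (y + 1 / 2) * ln (1 + 1 / y) - (?L 0 (y + 1) - ?L 0 y) = B"
      using eventually_gt_at_top[of 0]
    proof eventually_elim
      case (elim y)
      have Gamma_eq: "ln (Gamma (y + 1)) = ln y + ln (Gamma y)"
        using elim nonpos[OF elim] by (simp add: Gamma_plus1 ln_mult_pos)
      have "1 + 1 / y = (y + 1) / y"
        using elim by (simp add: field_simps)
      hence ln_eq: "ln (1 + 1 / y) = ln (y + 1) - ln y"
        using elim by (simp add: ln_div)
      have "1 - (y + 1 / 2) * ln (1 + 1 / y) = binet (y + 1) - binet y"
        unfolding binet_def Gamma_eq ln_eq by (simp add: field_simps)
      moreover have "d (y + 1) - d y = B"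
        using A[of y] A[of "y + 1"] elim by (simp add: algebra_simps)
      ultimately show ?case
        by (simp add: d_def)
    qed
    ultimately have "((\<lambda>_. B) \<longlongrightarrow> 0) (at_top :: real filter)"
      using Lim_transform_eventually by force
    thus ?thesis
      by (simp add: tendsto_const_iff)
  qed
  moreover have "A = 0"
  proof -
    \<comment> \<open>By duplication, \<open>1 / 2 - y * ln (1 + 1 / (2 * y))\<close> is
      \<open>binet y + binet (y + 1 / 2) - binet (2 * y)\<close>. As \<open>B = 0\<close>, the same
      combination of values of \<open>d\<close> is \<open>A + A - A\<close>.\<close>
    have "((\<lambda>y. 1 / 2 - y * ln (1 + 1 / (2 * y)) - (?L 0 y + ?L 0 (y + 1 / 2) - ?L 0 (2 * y))) \<longlongrightarrow> 0 - (0 + 0 - 0)) at_top"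
      by (intro tendsto_diff tendsto_add L_lim L_lim') real_asymp
    moreover have "\<forall>\<^sub>F y in at_top. 1 / 2 - y * ln (1 + 1 / (2 * y)) - (?L 0 y + ?L 0 (y + 1 / 2) - ?L 0 (2 * y)) = A"
      using eventually_gt_at_top[of 0]
    proof eventually_elim
      case (elim y)
      have "ln (Gamma y * Gamma (y + 1 / 2)) = ln (exp ((1 - 2 * y) * ln 2) * sqrt pi * Gamma (2 * y))"
        using elim by (simp add: Gamma_legendre_duplication_real)
      hence Gamma_eq: "ln (Gamma (y + 1 / 2)) = - ln (Gamma y) + (1 - 2 * y) * ln 2 + ln pi / 2 + ln (Gamma (2 * y))"
        using elim by (simp add: ln_mult_pos ln_sqrt)
      have "1 + 1 / (2 * y) = (y + 1 / 2) / y"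
        using elim by (simp add: field_simps)
      hence ln_eq: "ln (1 + 1 / (2 * y)) = ln (y + 1 / 2) - ln y"
        using elim by (simp add: ln_div)
      have ln_double: "ln (2 * y) = ln 2 + ln y" "ln (2 * pi) = ln 2 + ln pi"
        using elim by (simp_all add: ln_mult_pos)
      have "1 / 2 - y * ln (1 + 1 / (2 * y)) = binet y + binet (y + 1 / 2) - binet (2 * y)"
        unfolding binet_def Gamma_eq ln_eq ln_double by (simp add: field_simps)
      moreover have "d y + d (y + 1 / 2) - d (2 * y) = A"
        using A[of y] A[of "y + 1 / 2"] A[of "2 * y"] elim \<open>B = 0\<close> by simp
      ultimately show ?case
        by (simp add: d_def)
    qed
    ultimately have "((\<lambda>_. A) \<longlongrightarrow> 0) (at_top :: real filter)"
      using Lim_transform_eventually by force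
    thus ?thesis
      by (simp add: tendsto_const_iff)
  qed
  ultimately show ?thesis
    using A[OF x] by (simp add: d_def)
qed

section \<open>The remainder of the Stirling series\<close>

definition pole_density :: "nat \<Rightarrow> real \<Rightarrow> real" where
  "pole_density p t = (\<Sum>m. 2 / coth_pole m ^ (2 * p + 2) * Re (pole_kernel (coth_pole m) (2 * p + 1) t))"

lemma abs_Re_pole_kernel_le_1: "\<bar>Re (pole_kernel a N t)\<bar> \<le> 1"
  using abs_Re_le_cmod[of "pole_kernel a N t"] norm_pole_kernel_le_1[of a N t] by linarith

lemma pole_density_term_le:
  "\<bar>2 / coth_pole m ^ q * Re (pole_kernel (coth_pole m) N t)\<bar> \<le> 2 / coth_pole m ^ q"
proof -
  have pos: "2 / coth_pole m ^ q > 0"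
    by simp
  have "\<bar>2 / coth_pole m ^ q * Re (pole_kernel (coth_pole m) N t)\<bar> =
      2 / coth_pole m ^ q * \<bar>Re (pole_kernel (coth_pole m) N t)\<bar>"
    using pos by (simp only: abs_mult abs_of_pos)
  also have "\<dots> \<le> 2 / coth_pole m ^ q * 1"
    by (intro mult_left_mono abs_Re_pole_kernel_le_1 less_imp_le[OF pos])
  finally show ?thesis
    by simp
qed

lemma summable_pole_density:
  "summable (\<lambda>m. 2 / coth_pole m ^ (2 * p + 2) * Re (pole_kernel (coth_pole m) N t))"
  by (rule summable_comparison_test'[OF summable_coth_pole[of "2 * p + 2"], of 0])
     (simp_all only: real_norm_def pole_density_term_le le_add2)

lemma abs_pole_density_le: "\<bar>pole_density p t\<bar> \<le> coth_coeff p"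
  unfolding pole_density_def coth_coeff_def real_norm_def[symmetric]
  by (rule norm_suminf_le) (simp_all only: real_norm_def pole_density_term_le summable_coth_pole le_add2)

lemma borel_measurable_pole_density [measurable]: "pole_density p \<in> borel_measurable borel"
  unfolding pole_density_def by measurable

lemma isCont_pole_density: "isCont (pole_density p) t"
proof -
  have "uniform_limit UNIV (\<lambda>n t. \<Sum>m<n. 2 / coth_pole m ^ (2 * p + 2) * Re (pole_kernel (coth_pole m) (2 * p + 1) t))
      (\<lambda>t. \<Sum>m. 2 / coth_pole m ^ (2 * p + 2) * Re (pole_kernel (coth_pole m) (2 * p + 1) t)) sequentially"
    by (rule Weierstrass_m_test[where M = "\<lambda>m. 2 / coth_pole m ^ (2 * p + 2)"])
       (simp_all only: real_norm_def pole_density_term_le summable_coth_pole le_add2)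
  hence "uniform_limit UNIV (\<lambda>n t. \<Sum>m<n. 2 / coth_pole m ^ (2 * p + 2) * Re (pole_kernel (coth_pole m) (2 * p + 1) t))
      (pole_density p) sequentially"
    by (simp only: pole_density_def[abs_def])
  hence "continuous_on UNIV (pole_density p)"
    by (rule uniform_limit_theorem[rotated])
       (simp, intro always_eventually allI continuous_intros continuous_on_pole_kernel)
  thus ?thesis
    by (simp add: continuous_on_eq_continuous_at)
qed

lemma laplace_moment_pole_density:
  assumes "x > 0"
  shows "(\<lambda>m. 2 / coth_pole m ^ (2 * p + 2) * Re (pole_laplace (coth_pole m) N x)) sums
    laplace_moment (\<lambda>t. \<Sum>m. 2 / coth_pole m ^ (2 * p + 2) * Re (pole_kernel (coth_pole m) N t)) 0 x"
proof -
  have "(\<lambda>m. laplace_moment (\<lambda>t. 2 / coth_pole m ^ (2 * p + 2) * Re (pole_kernel (coth_pole m) N t)) 0 x) sums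
    laplace_moment (\<lambda>t. \<Sum>m. 2 / coth_pole m ^ (2 * p + 2) * Re (pole_kernel (coth_pole m) N t)) 0 x"
  proof (rule laplace_moment_sums)
    show "summable (\<lambda>m. 2 / coth_pole m ^ (2 * p + 2))"
      by (rule summable_coth_pole) simp
    show "norm (2 / coth_pole m ^ (2 * p + 2) * Re (pole_kernel (coth_pole m) N t)) \<le> 2 / coth_pole m ^ (2 * p + 2)"
      for m t
      unfolding real_norm_def by (rule pole_density_term_le)
  qed (use assms in measurable)
  moreover have "laplace_moment (\<lambda>t. c * Re (pole_kernel a N t)) 0 x = c * Re (pole_laplace a N x)" for c a
    unfolding laplace_moment_Re_pole_kernel[OF assms, symmetric] laplace_moment_def
    by (subst integral_mult_right_zero[symmetric]) (simp add: mult_ac)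
  ultimately show ?thesis
    by (simp only:)
qed

lemma binet_sums:
  assumes "x > 0"
  shows "(\<lambda>m. 2 / coth_pole m ^ 2 * Re (pole_laplace (coth_pole m) 1 x)) sums binet x"
proof -
  have "2 / coth_pole m ^ (2 * 0 + 2) * Re (pole_kernel (coth_pole m) 1 t) =
      2 / (coth_pole m ^ (2 * 0) * (t\<^sup>2 + coth_pole m ^ 2))" for m t
    using Re_pole_kernel_1[OF coth_pole_pos, of m t] by (simp only: mult_0_right add_0 power_0 mult_1)
  hence "(\<lambda>t. \<Sum>m. 2 / coth_pole m ^ (2 * 0 + 2) * Re (pole_kernel (coth_pole m) 1 t)) = coth_tail 0"
    by (simp only: coth_tail_def[abs_def])
  with laplace_moment_pole_density[OF assms, of 0 1] show ?thesis
    by (simp only: binet_eq_laplace[OF assms] mult_0_right add_0)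
qed

text \<open>The expansion for a single pole is summed over all poles: the inverse powers of
  \<open>coth_pole m\<close> in its polynomial part add up to the numbers
  \<open>coth_coeff i\<close>.\<close>

lemma power_times_binet:
  assumes x: "x > 0"
  shows "x ^ (2 * p) * binet x =
    (\<Sum>i<p. (-1) ^ i * fact (2 * i) * coth_coeff i * x ^ (2 * (p - Suc i) + 1)) +
    (-1) ^ p * fact (2 * p) * laplace_moment (pole_density p) 0 x"
proof -
  have "(\<lambda>m. x ^ (2 * p) * (2 / coth_pole m ^ 2 * Re (pole_laplace (coth_pole m) 1 x))) sums (x ^ (2 * p) * binet x)"
    by (intro sums_mult binet_sums x)
  moreover have "x ^ (2 * p) * (2 / coth_pole m ^ 2 * Re (pole_laplace (coth_pole m) 1 x)) =
      (\<Sum>i<p. (-1) ^ i * fact (2 * i) * x ^ (2 * (p - Suc i) + 1) * (2 / coth_pole m ^ (2 * i + 2))) +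
      (-1) ^ p * fact (2 * p) * (2 / coth_pole m ^ (2 * p + 2) * Re (pole_laplace (coth_pole m) (2 * p + 1) x))" for m
  proof -
    have "x ^ (2 * p) * (2 / coth_pole m ^ 2 * Re (pole_laplace (coth_pole m) 1 x)) =
        2 / coth_pole m ^ 2 * (x ^ (2 * p) * Re (pole_laplace (coth_pole m) 1 x))"
      by (simp only: mult_ac)
    also have "\<dots> = 2 / coth_pole m ^ 2 * (\<Sum>i<p. (-1) ^ i * fact (2 * i) / coth_pole m ^ (2 * i) * x ^ (2 * (p - Suc i) + 1)) +
        2 / coth_pole m ^ 2 * ((-1) ^ p * fact (2 * p) / coth_pole m ^ (2 * p) * Re (pole_laplace (coth_pole m) (2 * p + 1) x))"
      unfolding Re_pole_laplace_expansion[OF x coth_pole_pos] by (rule distrib_left)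
    also have "2 / coth_pole m ^ 2 * ((-1) ^ p * fact (2 * p) / coth_pole m ^ (2 * p) * Re (pole_laplace (coth_pole m) (2 * p + 1) x)) =
        (-1) ^ p * fact (2 * p) * (2 / coth_pole m ^ (2 * p + 2) * Re (pole_laplace (coth_pole m) (2 * p + 1) x))"
      by (simp add: power_add field_simps power2_eq_square)
    also have "2 / coth_pole m ^ 2 * (\<Sum>i<p. (-1) ^ i * fact (2 * i) / coth_pole m ^ (2 * i) * x ^ (2 * (p - Suc i) + 1)) =
        (\<Sum>i<p. (-1) ^ i * fact (2 * i) * x ^ (2 * (p - Suc i) + 1) * (2 / coth_pole m ^ (2 * i + 2)))"
      unfolding sum_distrib_left
      by (intro sum.cong refl) (simp add: power_add field_simps power2_eq_square)
    finally show ?thesis .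
  qed
  moreover have "(\<lambda>m. (\<Sum>i<p. (-1) ^ i * fact (2 * i) * x ^ (2 * (p - Suc i) + 1) * (2 / coth_pole m ^ (2 * i + 2))) +
      (-1) ^ p * fact (2 * p) * (2 / coth_pole m ^ (2 * p + 2) * Re (pole_laplace (coth_pole m) (2 * p + 1) x))) sums
      ((\<Sum>i<p. (-1) ^ i * fact (2 * i) * x ^ (2 * (p - Suc i) + 1) * coth_coeff i) +
      (-1) ^ p * fact (2 * p) * laplace_moment (pole_density p) 0 x)"
    using laplace_moment_pole_density[OF x, of p "2 * p + 1"]
    unfolding coth_coeff_def pole_density_def[abs_def]
    by (intro sums_add sums_sum sums_mult summable_sums summable_coth_pole) auto
  ultimately have "x ^ (2 * p) * binet x =
    (\<Sum>i<p. (-1) ^ i * fact (2 * i) * x ^ (2 * (p - Suc i) + 1) * coth_coeff i) +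
    (-1) ^ p * fact (2 * p) * laplace_moment (pole_density p) 0 x"
    by (simp only: sums_unique2)
  also have "(\<Sum>i<p. (-1) ^ i * fact (2 * i) * x ^ (2 * (p - Suc i) + 1) * coth_coeff i) =
      (\<Sum>i<p. (-1) ^ i * fact (2 * i) * coth_coeff i * x ^ (2 * (p - Suc i) + 1))"
    by (simp only: mult_ac)
  finally show ?thesis .
qed

text \<open>Shifts the sum to \<open>k = i + 1\<close>; dividing \<open>bernoulli (2 * k)\<close> by
  \<open>2 * k * (2 * k - 1)\<close> reduces the factorial of \<open>2 * i + 2\<close> to that of
  \<open>2 * i\<close>.\<close>

lemma gamma_remainder_eq:
  "gamma_remainder n x = (-1) ^ n * (binet x - (\<Sum>i<n. (-1) ^ i * fact (2 * i) * coth_coeff i / x ^ (2 * i + 1)))"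
proof -
  have "(\<Sum>k=1..n. bernoulli (2 * k) / (2 * real k * (2 * real k - 1)) * (1 / x ^ (2 * k - 1))) =
      (\<Sum>i<n. bernoulli (2 * Suc i) / (2 * real (Suc i) * (2 * real (Suc i) - 1)) * (1 / x ^ (2 * Suc i - 1)))"
    by (rule sum.reindex_bij_witness[of _ Suc "\<lambda>k. k - 1"]) auto
  also have "\<dots> = (\<Sum>i<n. (-1) ^ i * fact (2 * i) * coth_coeff i / x ^ (2 * i + 1))"
  proof (intro sum.cong refl)
    fix i
    have fact: "fact (2 * Suc i) = 2 * real (Suc i) * (2 * real (Suc i) - 1) * fact (2 * i)"
      by (simp add: algebra_simps)
    have nz: "2 * real (Suc i) * (2 * real (Suc i) - 1) \<noteq> 0"
      by simp
    have "bernoulli (2 * Suc i) = (-1) ^ i * coth_coeff i * fact (2 * Suc i)"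
      using bernoulli_even_eq_coth_coeff[of i] by (simp add: field_simps del: fact_Suc)
    hence "bernoulli (2 * Suc i) / (2 * real (Suc i) * (2 * real (Suc i) - 1)) = (-1) ^ i * fact (2 * i) * coth_coeff i"
      unfolding fact using nz by (simp add: divide_eq_eq mult_ac del: of_nat_Suc)
    moreover have "2 * Suc i - 1 = 2 * i + 1"
      by simp
    ultimately show "bernoulli (2 * Suc i) / (2 * real (Suc i) * (2 * real (Suc i) - 1)) * (1 / x ^ (2 * Suc i - 1)) =
        (-1) ^ i * fact (2 * i) * coth_coeff i / x ^ (2 * i + 1)"
      by (simp only: times_divide_eq_right mult_1_right)
  qed
  finally show ?thesis
    by (simp only: gamma_remainder_def binet_def)
qed

text \<open>The first \<open>p\<close> terms of the Stirling sum cancel the polynomial part of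
  \<open>power_times_binet\<close>. Only the last one survives, as the multiple of
  \<open>1 / x\<close>.\<close>

lemma power_times_gamma_remainder:
  assumes x: "x > 0"
  shows "x ^ (2 * p) * gamma_remainder (Suc p) x =
    fact (2 * p) * (coth_coeff p / x - laplace_moment (pole_density p) 0 x)"
proof -
  let ?L = "laplace_moment (pole_density p) 0 x"
  have "x ^ (2 * p) * gamma_remainder (Suc p) x = (-1) ^ Suc p *
      (x ^ (2 * p) * binet x - (\<Sum>i<Suc p. x ^ (2 * p) * ((-1) ^ i * fact (2 * i) * coth_coeff i / x ^ (2 * i + 1))))"
    unfolding gamma_remainder_eq by (simp only: sum_distrib_left right_diff_distrib mult_ac)
  also have "(\<Sum>i<Suc p. x ^ (2 * p) * ((-1) ^ i * fact (2 * i) * coth_coeff i / x ^ (2 * i + 1))) =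
      (\<Sum>i<p. (-1) ^ i * fact (2 * i) * coth_coeff i * x ^ (2 * (p - Suc i) + 1)) +
      (-1) ^ p * fact (2 * p) * coth_coeff p / x"
  proof -
    have "x ^ (2 * p) * ((-1) ^ i * fact (2 * i) * coth_coeff i / x ^ (2 * i + 1)) =
        (-1) ^ i * fact (2 * i) * coth_coeff i * x ^ (2 * (p - Suc i) + 1)" if "i < p" for i
    proof -
      have "2 * p = 2 * (p - Suc i) + 1 + (2 * i + 1)"
        using that by simp
      hence "x ^ (2 * p) = x ^ (2 * (p - Suc i) + 1) * x ^ (2 * i + 1)"
        by (simp only: power_add)
      thus ?thesis
        using x by simp
    qed
    thus ?thesis
      using x by simp
  qed
  also have "(-1) ^ Suc p * (x ^ (2 * p) * binet x -
      ((\<Sum>i<p. (-1) ^ i * fact (2 * i) * coth_coeff i * x ^ (2 * (p - Suc i) + 1)) +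
      (-1) ^ p * fact (2 * p) * coth_coeff p / x)) =
      ((-1) ^ Suc p * (-1) ^ p) * (fact (2 * p) * (?L - coth_coeff p / x))"
    unfolding power_times_binet[OF x] by (simp add: algebra_simps)
  also have "(-1) ^ Suc p * (-1) ^ p = (-1 :: real)"
    by (simp flip: power_mult_distrib)
  finally show ?thesis
    by (simp add: algebra_simps)
qed

section \<open>Behaviour near zero and sign of the density\<close>

text \<open>Bounding each transform by \<open>2 * coth_pole m\<close> costs one power of the pole,
  and for \<open>p > 0\<close> the remaining exponent \<open>2 * p + 1\<close> still gives a
  convergent series.\<close>

lemma laplace_moment_pole_density_bounded:
  assumes p: "p > 0"
  obtains K where "\<And>x. x > 0 \<Longrightarrow> \<bar>laplace_moment (pole_density p) 0 x\<bar> \<le> K"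
proof
  fix x :: real assume x: "x > 0"
  have summ: "summable (\<lambda>m. 2 * (2 / coth_pole m ^ (2 * p + 1)))"
    using p by (intro summable_mult summable_coth_pole) auto
  have le: "norm (2 / coth_pole m ^ (2 * p + 2) * Re (pole_laplace (coth_pole m) (2 * p + 1) x))
      \<le> 2 * (2 / coth_pole m ^ (2 * p + 1))" for m
  proof -
    have "norm (2 / coth_pole m ^ (2 * p + 2) * Re (pole_laplace (coth_pole m) (2 * p + 1) x))
        = 2 / coth_pole m ^ (2 * p + 2) * \<bar>Re (pole_laplace (coth_pole m) (2 * p + 1) x)\<bar>"
      by (simp add: abs_mult)
    also have "\<dots> \<le> 2 / coth_pole m ^ (2 * p + 2) * (2 * coth_pole m)"
      using norm_pole_laplace_Suc_le[OF x coth_pole_pos, of "2 * p" m] p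
        abs_Re_le_cmod[of "pole_laplace (coth_pole m) (2 * p + 1) x"]
      by (intro mult_left_mono) auto
    also have "\<dots> = 2 * (2 / coth_pole m ^ (2 * p + 1))"
      by simp
    finally show ?thesis .
  qed
  have "laplace_moment (pole_density p) 0 x =
      (\<Sum>m. 2 / coth_pole m ^ (2 * p + 2) * Re (pole_laplace (coth_pole m) (2 * p + 1) x))"
    using laplace_moment_pole_density[OF x, of p "2 * p + 1"]
    by (simp only: sums_iff pole_density_def[abs_def])
  thus "\<bar>laplace_moment (pole_density p) 0 x\<bar> \<le> (\<Sum>m. 2 * (2 / coth_pole m ^ (2 * p + 1)))"
    using norm_suminf_le[OF le summ] by simp
qed

text \<open>Equality holds at \<open>N = 3\<close>. Otherwise
  \<open>cos u \<ge> 1 - u\<^sup>2 / 2\<close> and \<open>pi \<le> 3.2\<close> give the base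
  \<open>1 - 5.12 / N\<^sup>2\<close>, and Bernoulli's inequality bounds its power below by
  \<open>1 - 5.12 / N\<close>. This is too weak at \<open>N = 5\<close>, which is computed
  directly.\<close>

lemma cos_pi_div_power_ge:
  assumes "N \<ge> 3" "odd N"
  shows "cos (pi / real N) ^ N \<ge> 1 / 8"
proof (cases "N = 3")
  case True
  thus ?thesis
    by (simp add: cos_60 power3_eq_cube)
next
  case False
  with assms have N: "N \<ge> 5"
    by presburger
  have "pi\<^sup>2 \<le> 3.2\<^sup>2"
    using pi_approx by (intro power_mono) auto
  hence pi2: "pi\<^sup>2 / 2 \<le> 5.12"
    by (simp add: power2_eq_square)
  have "1 - 5.12 / real N ^ 2 \<le> 1 - (pi / real N)\<^sup>2 / 2"
    using divide_right_mono[OF pi2, of "real N ^ 2"] by (simp add: power_divide)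
  also have "\<dots> \<le> cos (pi / real N)"
  proof -
    have "cos (pi / real N) = 1 - 2 * (sin (pi / real N / 2))\<^sup>2"
      using cos_double_sin[of "pi / real N / 2"] by simp
    moreover have "(sin (pi / real N / 2))\<^sup>2 \<le> (pi / real N / 2)\<^sup>2"
      using abs_sin_x_le_abs_x[of "pi / real N / 2"] by (simp only: abs_le_square_iff)
    moreover have "2 * (pi / real N / 2)\<^sup>2 = (pi / real N)\<^sup>2 / 2"
      by (simp add: power2_eq_square)
    ultimately show ?thesis
      by linarith
  qed
  finally have cos: "1 - 5.12 / real N ^ 2 \<le> cos (pi / real N)" .
  have "real N ^ 2 \<ge> 5 ^ 2"
    using N by (intro power_mono) auto
  hence base: "5.12 / real N ^ 2 \<le> 1"
    using N by (simp add: divide_le_eq)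
  have "1 / 8 \<le> (1 - 5.12 / real N ^ 2) ^ N"
  proof (cases "N = 5")
    case True
    thus ?thesis
      by (simp add: eval_nat_numeral)
  next
    case False
    with assms N have N: "N \<ge> 7"
      by presburger
    have "1 / 8 \<le> 1 - 5.12 / real N"
      using N by (simp add: field_simps)
    also have "\<dots> = 1 + real N * (- (5.12 / real N ^ 2))"
      using N by (simp add: power2_eq_square)
    also have "\<dots> \<le> (1 + - (5.12 / real N ^ 2)) ^ N"
      using base by (intro Bernoulli_inequality) simp
    finally show ?thesis
      by simp
  qed
  also have "\<dots> \<le> cos (pi / real N) ^ N"
    using base cos by (intro power_mono) auto
  finally show ?thesis .
qed

text \<open>The identity \<open>1 + \<i> * tan \<theta> = cis \<theta> / cos \<theta>\<close>
  reduces the power to de Moivre's formula.\<close>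

lemma pole_kernel_tan:
  assumes "a > 0" "cos \<theta> \<noteq> 0"
  shows "pole_kernel a N (a * tan \<theta>) = of_real (cos \<theta> ^ N) * cis (- (real N * \<theta>))"
proof -
  have "1 + \<i> * of_real (a * tan \<theta>) / of_real a = cis \<theta> / of_real (cos \<theta>)"
    using assms by (simp add: complex_eq_iff tan_def)
  moreover have "1 / (cis \<theta> / of_real (cos \<theta>)) ^ N = of_real (cos \<theta> ^ N) * cis (- (real N * \<theta>))"
  proof -
    have "1 / (cis \<theta> / of_real (cos \<theta>)) ^ N = of_real (cos \<theta> ^ N) * inverse (cis \<theta> ^ N)"
      by (simp add: power_divide inverse_eq_divide)
    thus ?thesis
      by (simp only: Complex.DeMoivre cis_inverse)
  qed
  ultimately show ?thesis
    by (simp only: pole_kernel_def)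
qed

lemma pole_density_negative:
  assumes p: "p > 0"
  obtains s where "s > 0" "pole_density p s < 0"
proof
  \<comment> \<open>At \<open>s\<close> the term of the smallest pole is \<open>- cos \<theta> ^ (2 * p + 1)\<close> times its maximum and outweighs the others.\<close>
  define \<theta> where "\<theta> = pi / real (2 * p + 1)"
  have \<theta>: "0 < \<theta>" "\<theta> < pi / 2"
    using p by (auto simp: \<theta>_def field_simps)
  define s where "s = coth_pole 0 * tan \<theta>"
  define A where "A = 2 / coth_pole 0 ^ (2 * p + 2)"
  define f where "f = (\<lambda>m. 2 / coth_pole m ^ (2 * p + 2) * Re (pole_kernel (coth_pole m) (2 * p + 1) s))"
  show "s > 0"
    unfolding s_def using \<theta> by (intro mult_pos_pos tan_gt_zero) auto
  have A: "A > 0"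
    by (simp add: A_def)
  have pole: "2 / coth_pole m ^ (2 * p + 2) = A / real (Suc m) ^ (2 * p + 2)" for m
  proof -
    have "coth_pole m = coth_pole 0 * real (Suc m)"
      by (simp add: coth_pole_def)
    thus ?thesis
      by (simp only: A_def power_mult_distrib divide_divide_eq_left)
  qed
  have f_le: "f m \<le> A / real (Suc m) ^ (2 * p + 2)" for m
    using pole_density_term_le[of m "2 * p + 2" "2 * p + 1" s] unfolding f_def pole by (rule abs_le_D1)
  have f0: "f 0 \<le> A * (- 1 / 8)"
  proof -
    \<comment> \<open>The angle satisfies \<open>(2 * p + 1) * \<theta> = pi\<close>, so the kernel
      of the first pole is real and negative.\<close>
    have "pole_kernel (coth_pole 0) (2 * p + 1) s = of_real (cos \<theta> ^ (2 * p + 1)) * cis (- pi)"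
    proof -
      have "cos \<theta> > 0"
        using \<theta> by (intro cos_gt_zero) auto
      moreover have "real (2 * p + 1) * \<theta> = pi"
        by (simp add: \<theta>_def add_eq_0_iff)
      ultimately show ?thesis
        using pole_kernel_tan[OF coth_pole_pos[of 0], of \<theta> "2 * p + 1"] by (simp add: s_def)
    qed
    hence "f 0 = A * - (cos \<theta> ^ (2 * p + 1))"
      by (simp add: f_def A_def)
    also have "\<dots> \<le> A * (- 1 / 8)"
      using cos_pi_div_power_ge[of "2 * p + 1"] p A unfolding \<theta>_def by (intro mult_left_mono) auto
    finally show ?thesis .
  qed
  have f1: "f 1 \<le> A * (1 / 16)"
  proof -
    have "(2 :: real) ^ 4 \<le> 2 ^ (2 * p + 2)"
      using p by (intro power_increasing) auto
    hence "A / 2 ^ (2 * p + 2) \<le> A / 16"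
      using A by (intro divide_left_mono) auto
    thus ?thesis
      using f_le[of 1] by simp
  qed
  \<comment> \<open>Since \<open>2 * p + 2 \<ge> 4\<close>, a factor of at least 9 can be split off,
    which leaves reciprocal squares whose sum is known exactly.\<close>
  have tail: "f (m + 2) \<le> A / 9 * (1 / (real (m + 2) + 1)\<^sup>2)" for m
  proof -
    have "9 * (real (m + 2) + 1)\<^sup>2 \<le> (real (m + 2) + 1)\<^sup>2 * (real (m + 2) + 1)\<^sup>2"
    proof (rule mult_right_mono)
      have "3\<^sup>2 \<le> (real (m + 2) + 1)\<^sup>2"
        by (intro power_mono) auto
      thus "9 \<le> (real (m + 2) + 1)\<^sup>2"
        by simp
    qed simp
    also have "\<dots> = (real (m + 2) + 1) ^ 4"
      by (simp flip: power_add)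
    also have "\<dots> \<le> (real (m + 2) + 1) ^ (2 * p + 2)"
      using p by (intro power_increasing) auto
    finally have "A / (real (m + 2) + 1) ^ (2 * p + 2) \<le> A / (9 * (real (m + 2) + 1)\<^sup>2)"
      using A by (intro divide_left_mono) (auto intro!: mult_pos_pos zero_less_power)
    thus ?thesis
      using f_le[of "m + 2"] by (simp add: add_ac)
  qed
  have summ: "summable f"
    unfolding f_def by (rule summable_pole_density)
  have "(\<lambda>m. 1 / (real (m + 2) + 1)\<^sup>2) sums (pi\<^sup>2 / 6 - (\<Sum>m<2. 1 / (real m + 1)\<^sup>2))"
    using inverse_squares_sums by (intro sums_split_initial_segment) (simp add: add_ac)
  hence squares: "(\<lambda>m. A / 9 * (1 / (real (m + 2) + 1)\<^sup>2)) sums (A / 9 * (pi\<^sup>2 / 6 - 5 / 4))"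
    by (intro sums_mult) (simp add: numeral_2_eq_2)
  have "(\<Sum>m. f (m + 2)) \<le> (\<Sum>m. A / 9 * (1 / (real (m + 2) + 1)\<^sup>2))"
    by (intro suminf_le tail summable_ignore_initial_segment summ sums_summable[OF squares])
  also have "\<dots> = A / 9 * (pi\<^sup>2 / 6 - 5 / 4)"
    using squares by (simp only: sums_iff)
  finally have "pole_density p s \<le> f 0 + f 1 + A / 9 * (pi\<^sup>2 / 6 - 5 / 4)"
    using suminf_split_initial_segment[OF summ, of 2] by (simp add: pole_density_def f_def numeral_2_eq_2)
  \<comment> \<open>Relative to \<open>A\<close>, the first pole gives at most -1/8, the second at
    most 1/16, and the bound for all others is below 1/16.\<close>
  also have "\<dots> \<le> A * (- 1 / 8 + 1 / 16 + (pi\<^sup>2 / 6 - 5 / 4) / 9)"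
    using f0 f1 by (simp add: algebra_simps)
  also have "\<dots> < 0"
  proof -
    have "pi\<^sup>2 \<le> 3.2\<^sup>2"
      using pi_approx by (intro power_mono) auto
    hence "- 1 / 8 + 1 / 16 + (pi\<^sup>2 / 6 - 5 / 4) / 9 < (0 :: real)"
      by (simp add: power2_eq_square)
    thus ?thesis
      using A by (simp add: mult_pos_neg)
  qed
  finally show "pole_density p s < 0" .
qed

section \<open>The degree of the remainder\<close>

lemma completely_monotonic_on_const: "c \<ge> 0 \<Longrightarrow> completely_monotonic_on I (\<lambda>_. c)"
  unfolding completely_monotonic_on_def
  by (intro exI[of _ "\<lambda>k _. if k = 0 then c else 0"]) auto

theorem proposition1p1:
  fixes n :: nat
  assumes "n \<ge> 2"
  shows "has_cm_degree (gamma_remainder n) (cm_degree (gamma_remainder n)) \<and>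
         2 * (real n - 1) \<le> cm_degree (gamma_remainder n) \<and> cm_degree (gamma_remainder n) < 2 * real n - 1"
proof -
  define p where "p = n - 1"
  have p: "n = Suc p" "p > 0"
    using assms by (auto simp: p_def)
  let ?R = "gamma_remainder n" and ?L = "laplace_moment (pole_density p) 0"
  \<comment> \<open>\<open>coth_coeff p / x\<close> is the transform of a constant, so
    \<open>G\<close> is the density of \<open>x ^ (2 * p) * ?R x\<close> up to a factorial. It is
    nonnegative because the constant bounds \<open>\<bar>pole_density p t\<bar>\<close>.\<close>
  define G where "G = (\<lambda>t. coth_coeff p - pole_density p t)"
  have G: "0 \<le> G t" "G t \<le> 2 * coth_coeff p" for t
    using abs_pole_density_le[of p t] by (auto simp: G_def)
  have G_measurable [measurable]: "G \<in> borel_measurable borel"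
    by (simp add: G_def)
  have laplace_G: "laplace_moment G 0 x = coth_coeff p / x - ?L x" if "x > 0" for x
  proof -
    have "integrable lborel (\<lambda>t. (indicator {0..} t * (t ^ 0 * exp (- x * t))) *\<^sub>R pole_density p t)"
      by (rule integrable_laplace_moment[OF _ _ that]) (use abs_pole_density_le in auto)
    moreover have "has_bochner_integral lborel (\<lambda>t. indicator {0..} t * (t ^ 0 * exp (- x * t)) * coth_coeff p)
        (fact 0 / x ^ Suc 0 * coth_coeff p)"
      by (intro has_bochner_integral_mult_left has_bochner_integral_power_exp that)
    ultimately show ?thesis
      by (simp add: laplace_moment_def G_def has_bochner_integral_iff right_diff_distrib)
  qed
  have remainder: "x ^ (2 * p) * ?R x = fact (2 * p) * laplace_moment G 0 x" if "x > 0" for x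
    using power_times_gamma_remainder[OF that, of p] laplace_G[OF that] by (simp add: p)
  have cm_2p: "completely_monotonic_on {0<..} (\<lambda>x. x powr (2 * real p) * ?R x)"
  proof -
    have "completely_monotonic_on {0<..} (\<lambda>x. fact (2 * p) * laplace_moment G 0 x)"
      using G by (intro completely_monotonic_on_mult completely_monotonic_on_const completely_monotonic_laplace) auto
    also have "?this \<longleftrightarrow> completely_monotonic_on {0<..} (\<lambda>x. x powr (2 * real p) * ?R x)"
    proof (rule completely_monotonic_on_cong)
      fix x :: real assume "x \<in> {0<..}"
      thus "fact (2 * p) * laplace_moment G 0 x = x powr (2 * real p) * ?R x"
        using remainder[of x] powr_realpow[of x "2 * p"] by simp
    qed
    finally show ?thesis .
  qed
  \<comment> \<open>Dividing by \<open>x powr (2 * real p)\<close> means multiplying by a completely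
    monotonic function, so this follows from \<open>cm_2p\<close>.\<close>
  have cm_R: "completely_monotonic_on {0<..} ?R"
  proof -
    have "completely_monotonic_on {0<..} (\<lambda>x. x powr - (2 * real p) * (x powr (2 * real p) * ?R x))"
      by (intro completely_monotonic_on_mult[OF completely_monotonic_on_powr_minus cm_2p]) simp
    also have "?this \<longleftrightarrow> completely_monotonic_on {0<..} ?R"
      by (intro completely_monotonic_on_cong) (auto simp flip: mult.assoc powr_add)
    finally show ?thesis .
  qed
  \<comment> \<open>The degree is defined after subtracting the limit at infinity, which has to be
    identified as 0.\<close>
  have "(?R \<longlongrightarrow> 0) at_top"
  proof (rule Lim_null_comparison)
    show "\<forall>\<^sub>F x in at_top. norm (?R x) \<le> fact (2 * p) * (2 * coth_coeff p) / x"
      using eventually_ge_at_top[of 1]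
    proof eventually_elim
      case (elim x)
      have "1 * norm (?R x) \<le> x ^ (2 * p) * norm (?R x)"
        using elim by (intro mult_right_mono one_le_power) auto
      also have "\<dots> = norm (x ^ (2 * p) * ?R x)"
        using elim by (simp add: abs_mult)
      also have "\<dots> = fact (2 * p) * norm (laplace_moment G 0 x)"
        using elim by (simp add: remainder abs_mult)
      also have "\<dots> \<le> fact (2 * p) * (2 * coth_coeff p * fact 0 / x ^ Suc 0)"
        using G elim by (intro mult_left_mono norm_laplace_moment_le) auto
      finally show ?case
        by simp
    qed
    show "((\<lambda>x. fact (2 * p) * (2 * coth_coeff p) / x) \<longlongrightarrow> 0) at_top"
      by real_asymp
  qed
  hence Lim: "Lim at_top ?R = 0"
    by (intro tendsto_Lim) auto
  have not_cm: "\<not> completely_monotonic_on {0<..} (\<lambda>x. x powr (2 * real p + 1) * ?R x)"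
  proof
    assume "completely_monotonic_on {0<..} (\<lambda>x. x powr (2 * real p + 1) * ?R x)"
    hence "completely_monotonic_on {0<..} (\<lambda>x. 1 / fact (2 * p) * (x powr (2 * real p + 1) * ?R x))"
      by (intro completely_monotonic_on_mult[OF completely_monotonic_on_const]) simp_all
    also have "?this \<longleftrightarrow> completely_monotonic_on {0<..} (\<lambda>x. coth_coeff p - x * ?L x)"
    proof (rule completely_monotonic_on_cong)
      fix x :: real assume "x \<in> {0<..}"
      hence x: "x > 0"
        by simp
      have "x powr (2 * real p + 1) = x * x ^ (2 * p)"
        using x powr_realpow[of x "2 * p"] by (simp add: powr_add)
      hence "1 / fact (2 * p) * (x powr (2 * real p + 1) * ?R x) = 1 / fact (2 * p) * (x * (x ^ (2 * p) * ?R x))"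
        by simp
      also have "\<dots> = x * (coth_coeff p / x - ?L x)"
        using remainder[OF x] laplace_G[OF x] by simp
      finally show "1 / fact (2 * p) * (x powr (2 * real p + 1) * ?R x) = coth_coeff p - x * ?L x"
        using x by (simp add: right_diff_distrib)
    qed
    finally have cm: "completely_monotonic_on {0<..} (\<lambda>x. coth_coeff p - x * ?L x)" .
    obtain K where K: "\<And>x. x > 0 \<Longrightarrow> \<bar>?L x\<bar> \<le> K"
      using laplace_moment_pole_density_bounded[OF p(2)] by blast
    \<comment> \<open>The transform is bounded on the positive half line, so the factor
      \<open>x\<close> forces the limit 0.\<close>
    have lim: "((\<lambda>x. x * ?L x) \<longlongrightarrow> 0) (at_right 0)"
    proof (rule Lim_null_comparison)
      show "\<forall>\<^sub>F x in at_right 0. norm (x * ?L x) \<le> x * K"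
        using eventually_at_right_less[of 0]
        by eventually_elim (use K in \<open>auto simp: abs_mult intro!: mult_left_mono\<close>)
      have "((\<lambda>x. x * K) \<longlongrightarrow> 0 * K) (at_right 0)"
        by (intro tendsto_intros)
      thus "((\<lambda>x. x * K) \<longlongrightarrow> 0) (at_right 0)"
        by simp
    qed
    obtain s where s: "s > 0" "pole_density p s < 0"
      using pole_density_negative[OF p(2)] .
    have "pole_density p s \<ge> 0"
      by (rule completely_monotonic_imp_nonneg_density[OF _ _ isCont_pole_density s(1) lim cm])
         (simp, rule abs_pole_density_le)
    with s(2) show False
      by simp
  qed
  show ?thesis
    using cm_degree_bounds[OF cm_R Lim _ cm_2p _ not_cm] by (simp add: p)
qed

end
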